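(* Let $d\ge2$ and let $s_0=0<s_1<\cdots<s_{d-1}$ be a sequence of integers. Put $g=\gcd(s_1,\ldots,s_{d-1})$, let $T$ be the numerical semigroup generated by $\frac{s_1}{g},\ldots,\frac{s_{d-1}}{g}$, let $c$ be the conductor of $T$, and let $$L=s_{d-1}s_{d-2}\left(\frac{gc+d\,s_{d-1}}{s_1}+d\right)-s_{d-1}-1 .$$ Then for any $e>L$, all the numerical semigroups $S=\langle n_1,\ldots,n_d\rangle$ with $n_1=e$ and shifting type $s_0,s_1,\ldots,s_{d-1}$ are homogeneous and $G(S)$ is Cohen-Macaulay.
   Context: A numerical semigroup is a submonoid of $(\mathbb N,+)$ with finite complement. The conductor of a numerical semigroup $T$ is the least $c\in T$ such that $c+i\in T$ for all $i>0$. A sequence of positive integers $n_1<\cdots<n_d$ (and the semigroup it generates) is of shifting type $s_0=0<s_1<\cdots<s_{d-1}$ if $s_i=n_d-n_{d-i}$ for all $1\le i\le d-1$. For $S$ with minimal generators $h_1<\cdots<h_r$, put $\mathrm{AP}(S,h_1)=\{x\in S: x-h_1\notin S\}$; $S$ is homogeneous if for each $0\ne s\in \mathrm{AP}(S,h_1)$ all $\mathbf a\in\mathbb N^r$ with $\sum a_ih_i=s$ have the same $\sum_i a_i$. $G(S)$ is the associated graded ring of $\Bbbk[S]=\Bbbk[t^{h_1},\ldots,t^{h_r}]$ ($\Bbbk$ a field) with respect to the ideal $(t^{h_1},\ldots,t^{h_r})$. *)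

theory Defs
  imports
    Complex_Main
    "HOL-Library.Extended_Nat"
    "HOL-Computational_Algebra.Polynomial"
    "HOL-Algebra.Ring_Divisibility"
    "HOL-Algebra.Ideal_Product"
    "HOL-Algebra.QuotRing"
begin

section \<open>Numerical semigroups\<close>

definition numerical_semigroup :: "nat set \<Rightarrow> bool" where
  "numerical_semigroup S \<longleftrightarrow>
     0 \<in> S \<and> (\<forall>x\<in>S. \<forall>y\<in>S. x + y \<in> S) \<and> finite (UNIV - S)"

inductive_set submonoid_gen :: "nat set \<Rightarrow> nat set" for A where
  zero: "0 \<in> submonoid_gen A"
| incl: "a \<in> A \<Longrightarrow> a \<in> submonoid_gen A"
| plus: "x \<in> submonoid_gen A \<Longrightarrow> y \<in> submonoid_gen A \<Longrightarrow> x + y \<in> submonoid_gen A"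

definition conductor :: "nat set \<Rightarrow> nat" where
  "conductor T = (LEAST c. c \<in> T \<and> (\<forall>i>0. c + i \<in> T))"

definition minimal_generating_set :: "nat set \<Rightarrow> nat set \<Rightarrow> bool" where
  "minimal_generating_set S H \<longleftrightarrow>
     submonoid_gen H = S \<and> (\<forall>H'. H' \<subset> H \<longrightarrow> submonoid_gen H' \<noteq> S)"

definition min_gens :: "nat set \<Rightarrow> nat set" where
  "min_gens S = (THE H. minimal_generating_set S H)"

text \<open>The description is proper: every submonoid of the natural numbers has exactly one
  minimal generating set.\<close>

lemma submonoid_gen_mono: "A \<subseteq> B \<Longrightarrow> x \<in> submonoid_gen A \<Longrightarrow> x \<in> submonoid_gen B"
proof -
  assume AB: "A \<subseteq> B" and "x \<in> submonoid_gen A"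
  from this(2) show ?thesis
    by induction (use AB in \<open>blast intro: submonoid_gen.intros\<close>)+
qed

lemma irreducible_in_generators:
  assumes "x \<in> submonoid_gen H" "x \<noteq> 0"
    and "\<And>y z. y \<in> submonoid_gen H \<Longrightarrow> z \<in> submonoid_gen H \<Longrightarrow> y \<noteq> 0 \<Longrightarrow> z \<noteq> 0 \<Longrightarrow> x \<noteq> y + z"
  shows "x \<in> H"
  using assms
proof induction
  case (plus x y)
  show ?case
  proof (cases "x = 0 \<or> y = 0")
    case True
    then consider "x = 0" | "y = 0" by blast
    then show ?thesis
    proof cases
      case 1
      then have eq: "x + y = y" by simp
      from plus.prems plus.IH(2) show ?thesis unfolding eq by blast
    next
      case 2
      then have eq: "x + y = x" by simp
      from plus.prems plus.IH(1) show ?thesis unfolding eq by blast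
    qed
  next
    case False
    with plus.prems(2)[of x y] plus.hyps show ?thesis by simp
  qed
qed auto

lemma irreducibles_generate:
  assumes "0 \<in> S" "\<And>x y. x \<in> S \<Longrightarrow> y \<in> S \<Longrightarrow> x + y \<in> S"
  shows "submonoid_gen {x\<in>S. x \<noteq> 0 \<and> (\<forall>y\<in>S. \<forall>z\<in>S. y \<noteq> 0 \<longrightarrow> z \<noteq> 0 \<longrightarrow> x \<noteq> y + z)} = S"
    (is "submonoid_gen ?M = S")
proof
  show "submonoid_gen ?M \<subseteq> S"
  proof
    fix x assume "x \<in> submonoid_gen ?M"
    then show "x \<in> S" by induction (use assms in auto)
  qed
  show "S \<subseteq> submonoid_gen ?M"
  proof
    fix x assume "x \<in> S"
    then show "x \<in> submonoid_gen ?M"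
    proof (induction x rule: less_induct)
      case (less x)
      show ?case
      proof (cases "x = 0 \<or> x \<in> ?M")
        case True
        then show ?thesis by (blast intro: submonoid_gen.intros)
      next
        case False
        with less.prems obtain y z where "y \<in> S" "z \<in> S" "y \<noteq> 0" "z \<noteq> 0" "x = y + z"
          by fast
        with less.IH[of y] less.IH[of z] show ?thesis
          by (simp add: submonoid_gen.plus)
      qed
    qed
  qed
qed

lemma minimal_generating_set_iff:
  assumes "0 \<in> S" "\<And>x y. x \<in> S \<Longrightarrow> y \<in> S \<Longrightarrow> x + y \<in> S"
  shows "minimal_generating_set S H \<longleftrightarrow>
    H = {x\<in>S. x \<noteq> 0 \<and> (\<forall>y\<in>S. \<forall>z\<in>S. y \<noteq> 0 \<longrightarrow> z \<noteq> 0 \<longrightarrow> x \<noteq> y + z)}"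
    (is "_ \<longleftrightarrow> H = ?M")
proof -
  have gen: "submonoid_gen ?M = S" by (rule irreducibles_generate) (use assms in auto)
  have sub: "?M \<subseteq> H" if "submonoid_gen H = S" for H
  proof
    fix x assume "x \<in> ?M"
    then show "x \<in> H"
      using irreducible_in_generators[of x H] unfolding that by blast
  qed
  show ?thesis
  proof
    assume H: "minimal_generating_set S H"
    then have "?M \<subseteq> H" by (intro sub) (simp add: minimal_generating_set_def)
    moreover have "\<not> ?M \<subset> H"
      using H gen unfolding minimal_generating_set_def by blast
    ultimately show "H = ?M" by blast
  next
    assume H: "H = ?M"
    have "submonoid_gen H' \<noteq> S" if "H' \<subset> H" for H'
      using sub[of H'] that unfolding H by blast
    then show "minimal_generating_set S H"
      using gen unfolding minimal_generating_set_def H by blast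
  qed
qed

lemma min_gens_eq:
  assumes "0 \<in> S" "\<And>x y. x \<in> S \<Longrightarrow> y \<in> S \<Longrightarrow> x + y \<in> S"
  shows "min_gens S = {x\<in>S. x \<noteq> 0 \<and> (\<forall>y\<in>S. \<forall>z\<in>S. y \<noteq> 0 \<longrightarrow> z \<noteq> 0 \<longrightarrow> x \<noteq> y + z)}"
proof -
  have "minimal_generating_set S H \<longleftrightarrow>
    H = {x\<in>S. x \<noteq> 0 \<and> (\<forall>y\<in>S. \<forall>z\<in>S. y \<noteq> 0 \<longrightarrow> z \<noteq> 0 \<longrightarrow> x \<noteq> y + z)}" for H
    by (rule minimal_generating_set_iff) (use assms in auto)
  then show ?thesis unfolding min_gens_def by (intro the_equality) blast+
qed

text \<open>The subtraction is integer subtraction: elements below \<open>h\<close> belong to the Apery set.\<close>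

definition apery :: "nat set \<Rightarrow> nat \<Rightarrow> nat set" where
  "apery S h = {x\<in>S. int x - int h \<notin> int ` S}"

text \<open>A factorization \<open>a\<close> is indexed by the minimal generators themselves; its values
  elsewhere are irrelevant.\<close>

definition homogeneous :: "nat set \<Rightarrow> bool" where
  "homogeneous S \<longleftrightarrow>
     (\<forall>x \<in> apery S (Min (min_gens S)). x \<noteq> 0 \<longrightarrow>
        (\<forall>a b :: nat \<Rightarrow> nat.
           (\<Sum>h\<in>min_gens S. a h * h) = x \<longrightarrow> (\<Sum>h\<in>min_gens S. b h * h) = x \<longrightarrow>
           (\<Sum>h\<in>min_gens S. a h) = (\<Sum>h\<in>min_gens S. b h)))"

definition shifting_type :: "nat \<Rightarrow> (nat \<Rightarrow> nat) \<Rightarrow> (nat \<Rightarrow> nat) \<Rightarrow> bool" where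
  "shifting_type d n s \<longleftrightarrow>
     (\<forall>i\<in>{1..d}. 0 < n i) \<and> strict_mono_on {1..d} n \<and>
     (\<forall>i\<in>{1..d - 1}. int (s i) = int (n d) - int (n (d - i)))"

section \<open>Cohen--Macaulay rings\<close>

definition krull_dim :: "('a, 'b) ring_scheme \<Rightarrow> enat" where
  "krull_dim R = Sup {enat k | k. \<exists>p. (\<forall>i\<le>k. primeideal (p i) R) \<and> (\<forall>i<k. p i \<subset> p (Suc i))}"

definition regular_sequence :: "('a, 'b) ring_scheme \<Rightarrow> 'a list \<Rightarrow> bool" where
  "regular_sequence R xs \<longleftrightarrow>
     set xs \<subseteq> carrier R \<and> Idl\<^bsub>R\<^esub> (set xs) \<noteq> carrier R \<and>
     (\<forall>i<length xs. \<forall>a\<in>carrier R.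
        xs ! i \<otimes>\<^bsub>R\<^esub> a \<in> Idl\<^bsub>R\<^esub> (set (take i xs)) \<longrightarrow> a \<in> Idl\<^bsub>R\<^esub> (set (take i xs)))"

definition depth :: "('a, 'b) ring_scheme \<Rightarrow> 'a set \<Rightarrow> enat" where
  "depth R I = Sup {enat (length xs) | xs. regular_sequence R xs \<and> set xs \<subseteq> I}"

definition cohen_macaulay_local :: "('a, 'b) ring_scheme \<Rightarrow> bool" where
  "cohen_macaulay_local R \<longleftrightarrow>
     cring R \<and> noetherian_ring R \<and>
     (\<exists>M. {J. maximalideal J R} = {M} \<and> depth R M = krull_dim R)"

definition frac_rel :: "('a, 'b) ring_scheme \<Rightarrow> 'a set \<Rightarrow> (('a \<times> 'a) \<times> ('a \<times> 'a)) set" where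
  "frac_rel R U = {((a, u), (b, v)) | a u b v.
     a \<in> carrier R \<and> b \<in> carrier R \<and> u \<in> U \<and> v \<in> U \<and>
     (\<exists>w\<in>U. w \<otimes>\<^bsub>R\<^esub> (v \<otimes>\<^bsub>R\<^esub> a \<ominus>\<^bsub>R\<^esub> u \<otimes>\<^bsub>R\<^esub> b) = \<zero>\<^bsub>R\<^esub>)}"

text \<open>\<open>localization R U\<close> inverts the multiplicative set \<open>U\<close>; the class of \<open>(a, u)\<close> is the
  fraction \<open>a / u\<close>.\<close>

definition localization :: "('a, 'b) ring_scheme \<Rightarrow> 'a set \<Rightarrow> ('a \<times> 'a) set ring" where
  "localization R U =
     \<lparr>carrier = (carrier R \<times> U) // frac_rel R U,
      mult = (\<lambda>X Y. \<Union>(a, u)\<in>X. \<Union>(b, v)\<in>Y. frac_rel R U `` {(a \<otimes>\<^bsub>R\<^esub> b, u \<otimes>\<^bsub>R\<^esub> v)}),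
      one = frac_rel R U `` {(\<one>\<^bsub>R\<^esub>, \<one>\<^bsub>R\<^esub>)},
      zero = frac_rel R U `` {(\<zero>\<^bsub>R\<^esub>, \<one>\<^bsub>R\<^esub>)},
      add = (\<lambda>X Y. \<Union>(a, u)\<in>X. \<Union>(b, v)\<in>Y.
               frac_rel R U `` {(v \<otimes>\<^bsub>R\<^esub> a \<oplus>\<^bsub>R\<^esub> u \<otimes>\<^bsub>R\<^esub> b, u \<otimes>\<^bsub>R\<^esub> v)})\<rparr>"

definition cohen_macaulay :: "('a, 'b) ring_scheme \<Rightarrow> bool" where
  "cohen_macaulay R \<longleftrightarrow>
     cring R \<and> noetherian_ring R \<and>
     (\<forall>M. maximalideal M R \<longrightarrow> cohen_macaulay_local (localization R (carrier R - M)))"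

section \<open>Associated graded rings\<close>

fun ideal_power :: "('a, 'b) ring_scheme \<Rightarrow> 'a set \<Rightarrow> nat \<Rightarrow> 'a set" where
  "ideal_power R I 0 = carrier R"
| "ideal_power R I (Suc k) = ideal_prod R (ideal_power R I k) I"

text \<open>An element \<open>f\<close> of the direct sum of the \<open>I\<^sup>k / I\<^sup>k\<^sup>+\<^sup>1\<close> is the family of its homogeneous
  components, \<open>f k\<close> being a coset of \<open>I\<^sup>k\<^sup>+\<^sup>1\<close> contained in \<open>I\<^sup>k\<close>. The product of \<open>a + I\<^sup>i\<^sup>+\<^sup>1\<close>
  and \<open>b + I\<^sup>j\<^sup>+\<^sup>1\<close> is \<open>ab + I\<^sup>i\<^sup>+\<^sup>j\<^sup>+\<^sup>1\<close>.\<close>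

definition assoc_graded :: "('a, 'b) ring_scheme \<Rightarrow> 'a set \<Rightarrow> (nat \<Rightarrow> 'a set) ring" where
  "assoc_graded R I =
     \<lparr>carrier = {f. (\<forall>k. \<exists>a\<in>ideal_power R I k. f k = ideal_power R I (Suc k) +>\<^bsub>R\<^esub> a) \<and>
                    finite {k. f k \<noteq> ideal_power R I (Suc k)}},
      mult = (\<lambda>f g k. \<Oplus>\<^bsub>R Quot ideal_power R I (Suc k)\<^esub>i\<in>{..k}.
                 rcoset_mult R (ideal_power R I (Suc k)) (f i) (g (k - i))),
      one = (\<lambda>k. if k = 0 then ideal_power R I 1 +>\<^bsub>R\<^esub> \<one>\<^bsub>R\<^esub> else ideal_power R I (Suc k)),
      zero = (\<lambda>k. ideal_power R I (Suc k)),
      add = (\<lambda>f g k. f k <+>\<^bsub>R\<^esub> g k)\<rparr>"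

section \<open>The semigroup ring and its associated graded ring\<close>

inductive_set subalgebra_gen :: "'k::field poly set \<Rightarrow> 'k poly set" for X where
  const: "[:a:] \<in> subalgebra_gen X"
| incl: "p \<in> X \<Longrightarrow> p \<in> subalgebra_gen X"
| plus: "p \<in> subalgebra_gen X \<Longrightarrow> q \<in> subalgebra_gen X \<Longrightarrow> p + q \<in> subalgebra_gen X"
| times: "p \<in> subalgebra_gen X \<Longrightarrow> q \<in> subalgebra_gen X \<Longrightarrow> p * q \<in> subalgebra_gen X"

definition gen_monomials :: "nat set \<Rightarrow> 'k::field poly set" where
  "gen_monomials S = (\<lambda>h. Polynomial.monom 1 h) ` min_gens S"

definition semigroup_ring :: "nat set \<Rightarrow> 'k::field poly ring" where
  "semigroup_ring S =
     \<lparr>carrier = subalgebra_gen (gen_monomials S), mult = (*), one = 1, zero = 0, add = (+)\<rparr>"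

definition graded_semigroup_ring :: "nat set \<Rightarrow> (nat \<Rightarrow> 'k::field poly set) ring" where
  "graded_semigroup_ring S =
     assoc_graded (semigroup_ring S) (Idl\<^bsub>semigroup_ring S\<^esub> (gen_monomials S))"

end

theory Submission
  imports Defs
begin

text \<open>Let \<open>D\<close> and \<open>e\<close> be the largest and the smallest generator. If an element has two
  factorizations of different lengths, then the deficits \<open>D - x\<close> of the members \<open>x\<close> of the longer one
  add up to at least \<open>D\<close>. As \<open>e\<close> is large, the pigeonhole principle modulo \<open>D - e\<close> turns it into a
  factorization of the same length that involves \<open>e\<close>. This gives homogeneity, and it also gives
  \<open>ord (x + e) = ord x + 1\<close>, where \<open>ord\<close> is the maximal length of a factorization.

  The associated graded ring has a basis of monomials indexed by \<open>S\<close>, in which the product of \<open>t\<^sup>i\<close>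
  and \<open>t\<^sup>j\<close> is \<open>t\<^sup>i\<^sup>+\<^sup>j\<close> if \<open>ord (i + j) = ord i + ord j\<close> and \<open>0\<close> otherwise. Hence \<open>z = t\<^sup>e\<close> is
  regular, the ring is a finite torsion-free module over \<open>k[z]\<close>, and the monomials that are not
  powers of \<open>z\<close> span a nilpotent ideal \<open>N\<close> with quotient \<open>k[z]\<close>. In the localization at a maximal
  ideal, every element is therefore nilpotent or, up to nilpotents, a unit times a power of one
  regular element \<open>f\<close>, so that the only primes are \<open>N\<close> and \<open>N + (f)\<close> and the depth is \<open>1\<close>.\<close>

section \<open>One-dimensional rings with a nilpotent minimal prime\<close>

text \<open>The bound on \<open>e\<close> is spent on the inequality (n_d - n_1)(n_d - n_2) \<le>
  n_d. It is what the pigeonhole principle asks for: members other than n_1 have deficits of at most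
  n_d - n_2, so if these add up to at least n_d, then at least n_d - n_1 of them are nonzero.

  Cohen-Macaulayness is required at every maximal ideal, including those that do not contain z. This
  is why the module structure over all of k[z] is carried along and not just the regularity of z:
  the contraction of a maximal ideal to k[z] is a nonzero principal ideal, and the image of its
  generator serves as the regular element f of the localization. Nonzero elements of k[z] act
  injectively because on the monomial basis they act by ordinary multiplication inside the domain
  k[t].

  The elements of the graded ring are families of cosets, which are awkward to compute with. The
  algebra is therefore done in a model whose elements are polynomials in t with a truncated product,
  and the properties that imply Cohen-Macaulayness are carried over by an isomorphism.\<close>

lemma (in cring) ideal_add_principal:
  assumes "ideal N R" "f \<in> carrier R"
  shows "ideal {z \<in> carrier R. \<exists>a\<in>carrier R. z \<ominus> f \<otimes> a \<in> N} R"
proof -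
  interpret N: ideal N R by fact
  have add: "\<exists>a\<in>carrier R. (x \<oplus> y) \<ominus> f \<otimes> a \<in> N"
    if x: "x \<in> carrier R" "a \<in> carrier R" "x \<ominus> f \<otimes> a \<in> N"
      and y: "y \<in> carrier R" "b \<in> carrier R" "y \<ominus> f \<otimes> b \<in> N" for x y a b
  proof (intro bexI)
    have "(x \<oplus> y) \<ominus> f \<otimes> (a \<oplus> b) = (x \<ominus> f \<otimes> a) \<oplus> (y \<ominus> f \<otimes> b)"
      using x y assms(2) by algebra
    then show "(x \<oplus> y) \<ominus> f \<otimes> (a \<oplus> b) \<in> N" using x y by simp
  qed (use x y in simp)
  have mult: "\<exists>b\<in>carrier R. (r \<otimes> x) \<ominus> f \<otimes> b \<in> N"
    if x: "x \<in> carrier R" "a \<in> carrier R" "x \<ominus> f \<otimes> a \<in> N" and r: "r \<in> carrier R" for x a r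
  proof (intro bexI)
    have "(r \<otimes> x) \<ominus> f \<otimes> (r \<otimes> a) = r \<otimes> (x \<ominus> f \<otimes> a)"
      using x r assms(2) by algebra
    then show "(r \<otimes> x) \<ominus> f \<otimes> (r \<otimes> a) \<in> N" using x r by (simp add: N.I_l_closed)
  qed (use x r in simp)
  have zero: "\<exists>a\<in>carrier R. \<zero> \<ominus> f \<otimes> a \<in> N"
    using assms(2) by (intro bexI[of _ \<zero>]) (simp_all add: minus_eq)

  then show ?thesis
  proof (intro idealI ring_axioms add.subgroupI, goal_cases)
    case 1
    then show ?case by auto
  next
    case 2
    then show ?case using zero by blast
  next
    case (3 x)
    then show ?case using mult[of x _ "\<ominus> \<one>"] by (auto simp: l_minus simp flip: a_inv_def)
  next
    case (4 x y)
    then show ?case using add by auto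
  next
    case (5 x r)
    then show ?case using mult by auto
  next
    case (6 x r)
    then have "r \<otimes> x = x \<otimes> r" by (auto simp: m_comm)
    then show ?case using 6 mult[of x _ r] by auto
  qed
qed

text \<open>Geometric series: (1 - x)(1 + x + ... + x^(k-1)) = 1 - x^k.\<close>

lemma (in cring) one_minus_nilpotent_Unit:
  assumes "x \<in> carrier R" "x [^] (k::nat) = \<zero>"
  shows "\<one> \<ominus> x \<in> Units R"
proof -
  have "\<exists>b\<in>carrier R. (\<one> \<ominus> x) \<otimes> b = \<one> \<ominus> x [^] k" for k :: nat
  proof (induction k)
    case 0
    then show ?case using assms by (intro bexI[of _ \<zero>]) (simp_all add: r_neg minus_eq)
  next
    case (Suc k)
    then obtain b where b: "b \<in> carrier R" "(\<one> \<ominus> x) \<otimes> b = \<one> \<ominus> x [^] k" by blast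
    define y where "y = x [^] k"
    have y: "y \<in> carrier R" using assms by (simp add: y_def)
    have "(\<one> \<ominus> x) \<otimes> (b \<oplus> y) = (\<one> \<ominus> x) \<otimes> b \<oplus> (\<one> \<ominus> x) \<otimes> y"
      using assms b y by algebra
    also have "\<dots> = (\<one> \<ominus> y) \<oplus> (\<one> \<ominus> x) \<otimes> y" unfolding b(2) y_def ..
    also have "\<dots> = \<one> \<ominus> y \<otimes> x"
      using assms b y by algebra
    finally show ?case using b y unfolding y_def by (intro bexI[of _ "b \<oplus> y"]) (simp_all add: y_def)
  qed
  from this[of k] obtain b where "b \<in> carrier R" "(\<one> \<ominus> x) \<otimes> b = \<one>"
    unfolding assms(2) by (auto simp: minus_eq)
  moreover have "\<one> \<ominus> x \<in> carrier R" using assms by simp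
  ultimately show ?thesis
    using m_comm unfolding Units_def by fastforce
qed

lemma (in ideal) Unit_imp_carrier:
  assumes "u \<in> I" "u \<in> Units R"
  shows "I = carrier R"
  using assms I_l_closed[of u "inv u"] one_imp_carrier by simp

lemma (in cring) divisor_of_Unit:
  assumes "a \<in> carrier R" "b \<in> carrier R" "a \<otimes> b \<in> Units R"
  shows "a \<in> Units R"
proof -
  have "a \<otimes> (b \<otimes> inv (a \<otimes> b)) = \<one>"
    using assms by (simp flip: m_assoc)
  moreover have "b \<otimes> inv (a \<otimes> b) \<in> carrier R" using assms by simp
  ultimately show ?thesis
    using assms m_comm unfolding Units_def by fastforce
qed

lemma (in primeideal) nat_pow_mem_imp:
  assumes "a \<in> carrier R" "a [^] (k::nat) \<in> I"
  shows "a \<in> I"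
  using assms(2)
proof (induction k)
  case 0
  then show ?case using one_imp_carrier I_notcarr by simp
next
  case (Suc k)
  then have "a [^] k \<otimes> a \<in> I" by simp
  then show ?case using I_prime[of "a [^] k" a] assms(1) Suc.IH by blast
qed

text \<open>The quotient by \<open>N\<close> is a discrete valuation ring with uniformizer
  \<open>f\<close>. The regularity of \<open>f\<close> is assumed in the ring itself and not only
  modulo \<open>N\<close>; it is what makes the depth positive.\<close>

locale nil_uniformizer = cring +
  fixes N f
  assumes N: "ideal N R"
    and nil: "z \<in> N \<Longrightarrow> \<exists>k::nat. z [^] k = \<zero>"
    and f: "f \<in> carrier R" "f \<notin> Units R"
    and f_regular: "z \<in> carrier R \<Longrightarrow> f \<otimes> z = \<zero> \<Longrightarrow> z = \<zero>"
    and decomp: "z \<in> carrier R \<Longrightarrow> z \<notin> N \<Longrightarrow> \<exists>u\<in>Units R. \<exists>j::nat. z \<ominus> u \<otimes> f [^] j \<in> N"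
begin

sublocale N: ideal N R by (rule N)

definition M where "M = {z \<in> carrier R. \<exists>a\<in>carrier R. z \<ominus> f \<otimes> a \<in> N}"

lemma M_ideal: "ideal M R"
  unfolding M_def using ideal_add_principal N f by simp

sublocale M: ideal M R by (rule M_ideal)

lemma N_subset_M: "N \<subseteq> M"
proof
  fix z assume z: "z \<in> N"
  then have "z \<ominus> f \<otimes> \<zero> = z" using f(1) N.Icarr[OF z] by algebra
  then show "z \<in> M" using z N.Icarr[OF z] unfolding M_def by force
qed

lemma f_in_M: "f \<in> M"
proof -
  have "f \<ominus> f \<otimes> \<one> = \<zero>" using f(1) by algebra
  then show ?thesis using f(1) N.zero_closed unfolding M_def by (metis (mono_tags, lifting) mem_Collect_eq one_closed)
qed

lemma f_pow_regular: "z \<in> carrier R \<Longrightarrow> f [^] (k::nat) \<otimes> z = \<zero> \<Longrightarrow> z = \<zero>"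
proof (induction k)
  case 0
  then show ?case by simp
next
  case (Suc k)
  have "f \<otimes> (f [^] k \<otimes> z) = f [^] Suc k \<otimes> z"
    using f Suc.prems(1) by (simp add: m_ac)
  then have "f [^] k \<otimes> z = \<zero>"
    using Suc.prems f(1) f_regular[of "f [^] k \<otimes> z"] by (metis m_closed nat_pow_closed)
  then show ?case using Suc by blast
qed

text \<open>Otherwise a multiple of \<open>f\<close> would be 1 minus a nilpotent element, hence a
  unit, and \<open>f\<close> with it.\<close>

lemma one_not_in_M: "\<one> \<notin> M"
proof
  assume "\<one> \<in> M"
  then obtain a where a: "a \<in> carrier R" "\<one> \<ominus> f \<otimes> a \<in> N" unfolding M_def by blast
  then obtain k :: nat where k: "(\<one> \<ominus> f \<otimes> a) [^] k = \<zero>" using nil by blast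
  have "\<one> \<ominus> (\<one> \<ominus> f \<otimes> a) \<in> Units R"
    by (rule one_minus_nilpotent_Unit[OF _ k]) (use a(1) f(1) in blast)
  also have "\<one> \<ominus> (\<one> \<ominus> f \<otimes> a) = f \<otimes> a" using a(1) f(1) by algebra
  finally show False using divisor_of_Unit[OF f(1) a(1)] f(2) by blast
qed

lemma one_neq_zero: "\<one> \<noteq> \<zero>"
  using one_not_in_M M.zero_closed by metis

lemma M_neq_carrier: "M \<noteq> carrier R"
  using one_not_in_M by blast

lemma f_pow_not_in_N: "f [^] (k::nat) \<notin> N"
proof
  assume "f [^] k \<in> N"
  then obtain j :: nat where "(f [^] k) [^] j = \<zero>" using nil by blast
  then have "f [^] (k * j) \<otimes> \<one> = \<zero>" using f by (simp add: nat_pow_pow)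
  then show False using f_pow_regular[of \<one> "k * j"] one_neq_zero by blast
qed

lemma nilpotent_in_prime:
  assumes "primeideal p R" shows "N \<subseteq> p"
proof
  fix z assume z: "z \<in> N"
  then obtain k :: nat where k: "z [^] k = \<zero>" using nil by blast
  interpret p: primeideal p R by fact
  show "z \<in> p" using p.nat_pow_mem_imp[of z k] N.Icarr[OF z] k by simp
qed

lemma not_N_f_pow:
  assumes "ideal J R" "N \<subseteq> J" "z \<in> J" "z \<notin> N"
  obtains k :: nat where "f [^] k \<in> J"
proof -
  interpret J: ideal J R by fact
  obtain u j where u: "u \<in> Units R" "z \<ominus> u \<otimes> f [^] (j::nat) \<in> N"
    using decomp[OF J.Icarr[OF assms(3)] assms(4)] by blast
  have c: "z \<in> carrier R" "u \<in> carrier R" "f [^] j \<in> carrier R"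
    using J.Icarr[OF assms(3)] u(1) f(1) by auto
  have "u \<otimes> f [^] j = z \<oplus> (\<ominus> \<one>) \<otimes> (z \<ominus> u \<otimes> f [^] j)"
    using c by algebra
  also have "\<dots> \<in> J"
    using u(2) assms(2) by (intro J.a_closed[OF assms(3)] J.I_l_closed) auto
  finally have "inv u \<otimes> (u \<otimes> f [^] j) \<in> J" by (rule J.I_l_closed) (use u in auto)
  also have "inv u \<otimes> (u \<otimes> f [^] j) = f [^] j"
    using u(1) c by (simp flip: m_assoc)
  finally show ?thesis using that by blast
qed

lemma proper_subset_M:
  assumes "ideal J R" "J \<noteq> carrier R" shows "J \<subseteq> M"
proof
  interpret J: ideal J R by fact
  fix z assume z: "z \<in> J"
  then have zc: "z \<in> carrier R" by (rule J.Icarr)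
  show "z \<in> M"
  proof (rule ccontr)
    assume nM: "z \<notin> M"
    then obtain u j where u: "u \<in> Units R" "z \<ominus> u \<otimes> f [^] (j::nat) \<in> N"
      using decomp zc N_subset_M by blast
    show False
    proof (cases j)
      case 0
      \<comment> \<open>For exponent 0, \<open>z\<close> differs from the unit \<open>u\<close> by a
        nilpotent element. Scaling by \<open>inv u\<close> brings this to the form 1 minus a
        nilpotent element, so \<open>z\<close> is a unit of the proper ideal
        \<open>J\<close>.\<close>
      define v where "v = \<one> \<ominus> inv u \<otimes> z"
      have c: "u \<in> carrier R" "inv u \<in> carrier R" using u by auto
      have "v = (\<ominus> (inv u)) \<otimes> (z \<ominus> u)"
      proof -
        have "(\<ominus> (inv u)) \<otimes> (z \<ominus> u) = inv u \<otimes> u \<ominus> inv u \<otimes> z"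
          using c zc by algebra
        then show ?thesis using u by (simp add: v_def)
      qed
      also have "\<dots> \<in> N" by (rule N.I_l_closed) (use u(2) 0 c in auto)
      finally obtain k :: nat where "v [^] k = \<zero>" using nil by blast
      then have "\<one> \<ominus> v \<in> Units R"
        using one_minus_nilpotent_Unit[of v k] c zc by (simp add: v_def)
      also have "\<one> \<ominus> v = z \<otimes> inv u" unfolding v_def using c zc by algebra
      finally have "z \<in> Units R" using divisor_of_Unit c zc by blast
      then show False using J.Unit_imp_carrier z assms(2) by blast
    next
      case (Suc i)
      have c: "u \<in> carrier R" "f [^] i \<in> carrier R" using u f by auto
      have "u \<otimes> f [^] j = f \<otimes> (u \<otimes> f [^] i)" using c f Suc by (simp add: m_ac)
      then have "z \<in> M" using u c zc unfolding M_def by auto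
      then show False using nM by blast
    qed
  qed
qed

lemma M_maximal: "maximalideal M R"
proof (rule maximalidealI)
  fix J assume "ideal J R" "M \<subseteq> J" "J \<subseteq> carrier R"
  then show "J = M \<or> J = carrier R" using proper_subset_M[of J] by blast
qed (use M_ideal M_neq_carrier in auto)

lemma maximal_ideals: "{J. maximalideal J R} = {M}"
proof -
  have "J = M" if "maximalideal J R" for J
  proof -
    interpret J: maximalideal J R by fact
    have "J \<subseteq> M" using proper_subset_M J.is_ideal J.I_notcarr by blast
    then show ?thesis using J.I_maximal[OF M_ideal] M_neq_carrier M.a_subset by blast
  qed
  then show ?thesis using M_maximal by blast
qed

lemma N_prime: "primeideal N R"
proof (rule primeidealI)
  show "carrier R \<noteq> N" using N_subset_M M_neq_carrier M.a_subset by blast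
  fix a b assume ab: "a \<in> carrier R" "b \<in> carrier R" "a \<otimes> b \<in> N"
  show "a \<in> N \<or> b \<in> N"
  proof (rule ccontr)
    assume "\<not> ?thesis"
    then obtain u i v j where uv: "u \<in> Units R" "a \<ominus> u \<otimes> f [^] (i::nat) \<in> N"
      "v \<in> Units R" "b \<ominus> v \<otimes> f [^] (j::nat) \<in> N"
      using decomp ab by meson
    define p q where "p = f [^] i" and "q = f [^] j"
    have c: "u \<in> carrier R" "v \<in> carrier R" "p \<in> carrier R" "q \<in> carrier R"
      using uv f by (auto simp: p_def q_def)
    have "(u \<otimes> v) \<otimes> (p \<otimes> q) = a \<otimes> b \<oplus> (\<ominus> b) \<otimes> (a \<ominus> u \<otimes> p) \<oplus> (\<ominus> (u \<otimes> p)) \<otimes> (b \<ominus> v \<otimes> q)"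
      using c ab by algebra
    also have "\<dots> \<in> N"
    proof (intro N.a_closed)
      show "(\<ominus> b) \<otimes> (a \<ominus> u \<otimes> p) \<in> N"
        by (rule N.I_l_closed) (use uv(2) ab in \<open>simp_all add: p_def\<close>)
      show "(\<ominus> (u \<otimes> p)) \<otimes> (b \<ominus> v \<otimes> q) \<in> N"
        by (rule N.I_l_closed) (use uv(4) c in \<open>simp_all add: q_def\<close>)
    qed fact
    finally have "inv (u \<otimes> v) \<otimes> ((u \<otimes> v) \<otimes> (p \<otimes> q)) \<in> N"
      by (rule N.I_l_closed) (use uv in auto)
    also have "inv (u \<otimes> v) \<otimes> ((u \<otimes> v) \<otimes> (p \<otimes> q)) = p \<otimes> q"
      using uv c by (metis Units_inv_closed Units_l_inv Units_m_closed l_one m_assoc m_closed)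
    also have "\<dots> = f [^] (i + j)" using f by (simp add: p_def q_def nat_pow_mult)
    finally show False using f_pow_not_in_N by blast
  qed
qed (use N is_cring in auto)

text \<open>A prime contains all nilpotent elements, so it contains \<open>N\<close>. If it is
  larger than \<open>N\<close>, it contains a power of \<open>f\<close> by \<open>decomp\<close>,
  hence \<open>f\<close>, hence \<open>M\<close>, which is maximal.\<close>

lemma prime_ideals: "primeideal p R \<longleftrightarrow> p = N \<or> p = M"
proof
  assume p: "primeideal p R"
  interpret p: primeideal p R by fact
  have Np: "N \<subseteq> p" using nilpotent_in_prime p by blast
  show "p = N \<or> p = M"
  proof (cases "p = N")
    case False
    then obtain z where "z \<in> p" "z \<notin> N" using Np by blast
    then obtain k :: nat where "f [^] k \<in> p" using not_N_f_pow p.is_ideal Np by blast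
    then have fp: "f \<in> p" using p.nat_pow_mem_imp f by blast
    have "z \<in> p" if "z \<in> M" for z
    proof -
      from that obtain a where a: "z \<in> carrier R" "a \<in> carrier R" "z \<ominus> f \<otimes> a \<in> N"
        unfolding M_def by blast
      have "z = (z \<ominus> f \<otimes> a) \<oplus> f \<otimes> a" using a f by algebra
      also have "\<dots> \<in> p" using a Np fp by (intro p.a_closed p.I_r_closed) auto
      finally show ?thesis .
    qed
    then show ?thesis using proper_subset_M p.is_ideal p.I_notcarr by blast
  qed simp
next
  assume "p = N \<or> p = M"
  then show "primeideal p R" using N_prime M_maximal maximalideal_prime by blast
qed

lemma krull_dim_eq_1: "krull_dim R = 1"
proof -
  have "N \<noteq> M" using f_pow_not_in_N[of 1] f_in_M f by auto
  then have NM: "N \<subset> M" using N_subset_M by blast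
  define p where "p = (\<lambda>i::nat. if i = 0 then N else M)"
  have "primeideal (p i) R" for i
    unfolding prime_ideals p_def by metis
  moreover have "\<forall>i<1. p i \<subset> p (Suc i)" using NM by (simp add: p_def)
  ultimately have "enat 1 \<in> {enat k | k. \<exists>p. (\<forall>i\<le>k. primeideal (p i) R) \<and> (\<forall>i<k. p i \<subset> p (Suc i))}"
    by blast
  moreover have "enat k \<le> enat 1" if "\<forall>i\<le>k. primeideal (p i) R" "\<forall>i<k. p i \<subset> p (Suc i)" for p k
  proof (rule ccontr)
    assume "\<not> enat k \<le> enat 1"
    then have "p 0 \<subset> p 1" "p 1 \<subset> p 2" "primeideal (p 0) R" "primeideal (p 1) R" "primeideal (p 2) R"
      using that(1)[rule_format, of 0] that(1)[rule_format, of 1] that(1)[rule_format, of 2]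
        that(2)[rule_format, of 0] that(2)[rule_format, of 1] by (simp_all add: numeral_2_eq_2)
    then show False using NM unfolding prime_ideals by blast
  qed
  ultimately show ?thesis unfolding krull_dim_def one_enat_def
  proof (intro Sup_eqI, goal_cases)
    case (1 y)
    then show ?case by auto
  next
    case (2 y)
    then show ?case by meson
  qed
qed

lemma Idl_empty: "Idl {} = {\<zero>}"
proof -
  have "ideal (Idl {}) R" by (rule genideal_ideal) simp
  then have "\<zero> \<in> Idl {}" by (simp add: additive_subgroup.zero_closed ideal.axioms(1))
  then show ?thesis using genideal_minimal[OF zeroideal, of "{}"] by auto
qed

lemma regular_sequence_f: "regular_sequence R [f]"
proof -
  have "Idl {f} \<subseteq> M" by (rule genideal_minimal[OF M_ideal]) (use f_in_M in simp)
  then have "Idl {f} \<noteq> carrier R" using one_not_in_M by blast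
  then show ?thesis
    using f(1) f_regular unfolding regular_sequence_def by (simp add: Idl_empty)
qed

text \<open>The first element \<open>a\<close> of such a sequence is regular, hence not nilpotent,
  so some power of \<open>f\<close> is a multiple of \<open>a\<close>. A second element
  \<open>b\<close> is a multiple of \<open>f\<close> up to nilpotents, so some power of
  \<open>b\<close> is a multiple of \<open>a\<close> as well. This contradicts the regularity of
  \<open>b\<close> modulo \<open>a\<close>.\<close>

lemma regular_sequence_length_le_1:
  assumes reg: "regular_sequence R xs" and sub: "set xs \<subseteq> M"
  shows "enat (length xs) \<le> enat 1"
proof (rule ccontr)
  assume "\<not> enat (length xs) \<le> enat 1"
  then obtain a b ys where xs: "xs = a # b # ys"
    by (cases xs; cases "tl xs") auto
  have ab: "a \<in> carrier R" "b \<in> carrier R" "a \<in> M" "b \<in> M" using reg sub by (auto simp: xs regular_sequence_def)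
  have *: "\<forall>i<length xs. \<forall>a\<in>carrier R. xs ! i \<otimes> a \<in> Idl (set (take i xs)) \<longrightarrow> a \<in> Idl (set (take i xs))"
    using reg unfolding regular_sequence_def by blast
  have areg: "z = \<zero>" if "z \<in> carrier R" "a \<otimes> z = \<zero>" for z
    using *[rule_format, of 0 z] that by (simp add: xs Idl_empty)
  have breg: "z \<in> Idl {a}" if "z \<in> carrier R" "b \<otimes> z \<in> Idl {a}" for z
    using *[rule_format, of 1 z] that by (simp add: xs)
  have aN: "a \<notin> N"
  proof
    assume "a \<in> N"
    then obtain k :: nat where k: "a [^] k = \<zero>" using nil by blast
    have "a [^] k \<noteq> \<zero>" for k :: nat
    proof (induction k)
      case 0
      then show ?case using one_neq_zero by simp
    next
      case (Suc k)
      have "a [^] Suc k = a \<otimes> a [^] k" using ab by (simp add: m_comm)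
      then show ?case using areg[of "a [^] k"] ab Suc by auto
    qed
    then show False using k by blast
  qed
  interpret A: ideal "Idl {a}" R using ab by (simp add: genideal_ideal)
  have "a \<in> Idl {a}" using ab genideal_self' by blast
  obtain i :: nat where "f [^] i \<in> Idl {a}"
  proof -
    obtain u j where u: "u \<in> Units R" "a \<ominus> u \<otimes> f [^] (j::nat) \<in> N"
      using decomp ab aN by blast
    define y where "y = f [^] j \<ominus> inv u \<otimes> a"
    have c: "u \<in> carrier R" "inv u \<in> carrier R" "f [^] j \<in> carrier R" using u f by auto
    have yc: "y \<in> carrier R" using c ab by (simp add: y_def)
    have "(\<ominus> (inv u)) \<otimes> (a \<ominus> u \<otimes> f [^] j) = (inv u \<otimes> u) \<otimes> f [^] j \<ominus> inv u \<otimes> a"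
      using c ab by algebra
    also have "\<dots> = y" using u c by (simp add: y_def)
    finally have "y \<in> N" using u c N.I_l_closed by (metis a_inv_closed)
    then obtain k :: nat where k: "y [^] k = \<zero>" using nil by blast
    \<comment> \<open>\<open>f [^] j\<close> and \<open>y\<close> are congruent modulo
      \<open>a\<close>, so their powers are. Since \<open>y\<close> is nilpotent, some power of
      \<open>f\<close> is congruent to 0.\<close>
    have "\<exists>r\<in>carrier R. (f [^] j) [^] k \<ominus> y [^] k = r \<otimes> a" for k :: nat
    proof (induction k)
      case 0
      then show ?case using ab by (intro bexI[of _ \<zero>]) (auto simp: r_neg minus_eq)
    next
      case (Suc k)
      then obtain r where r: "r \<in> carrier R" "(f [^] j) [^] k \<ominus> y [^] k = r \<otimes> a" by blast
      define p q g where "p = (f [^] j) [^] k" and "q = y [^] k" and "g = f [^] j"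
      have d: "p \<in> carrier R" "q \<in> carrier R" "g \<in> carrier R" using c yc by (auto simp: p_def q_def g_def)
      have "p \<otimes> g \<ominus> q \<otimes> y = (p \<ominus> q) \<otimes> g \<oplus> q \<otimes> (inv u \<otimes> a)"
        unfolding y_def g_def[symmetric] using d c ab by algebra
      also have "\<dots> = (r \<otimes> a) \<otimes> g \<oplus> q \<otimes> (inv u \<otimes> a)"
        using r(2) by (simp add: p_def q_def)
      also have "\<dots> = (r \<otimes> g \<oplus> q \<otimes> inv u) \<otimes> a"
        using d c ab r by algebra
      finally show ?case using d c r
        by (intro bexI[of _ "r \<otimes> g \<oplus> q \<otimes> inv u"]) (auto simp: p_def q_def g_def)
    qed
    from this[of k] obtain r where "r \<in> carrier R" "(f [^] j) [^] k = r \<otimes> a"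
      unfolding k using c by (auto simp: minus_eq)
    then have "f [^] (j * k) \<in> Idl {a}"
      using f A.I_l_closed[OF \<open>a \<in> Idl {a}\<close>] by (simp add: nat_pow_pow)
    then show ?thesis using that by blast
  qed
  obtain y where y: "y \<in> carrier R" "b \<ominus> f \<otimes> y \<in> N" using ab(4) unfolding M_def by blast
  then obtain k :: nat where k: "(b \<ominus> f \<otimes> y) [^] k = \<zero>" using nil by blast
  \<comment> \<open>The same argument modulo \<open>f\<close>: \<open>b\<close> is congruent to the
    nilpotent element \<open>b \<ominus> f \<otimes> y\<close>.\<close>
  have "\<exists>r\<in>carrier R. b [^] k \<ominus> (b \<ominus> f \<otimes> y) [^] k = f \<otimes> r" for k :: nat
  proof (induction k)
    case 0
    then show ?case using f by (intro bexI[of _ \<zero>]) (auto simp: r_neg minus_eq)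
  next
    case (Suc k)
    then obtain r where r: "r \<in> carrier R" "b [^] k \<ominus> (b \<ominus> f \<otimes> y) [^] k = f \<otimes> r" by blast
    define p q where "p = b [^] k" and "q = (b \<ominus> f \<otimes> y) [^] k"
    have d: "p \<in> carrier R" "q \<in> carrier R" using ab y f by (auto simp: p_def q_def)
    have "p \<otimes> b \<ominus> q \<otimes> (b \<ominus> f \<otimes> y) = (p \<ominus> q) \<otimes> b \<oplus> q \<otimes> (f \<otimes> y)"
      using d ab y f by algebra
    also have "\<dots> = (f \<otimes> r) \<otimes> b \<oplus> q \<otimes> (f \<otimes> y)"
      using r(2) by (simp add: p_def q_def)
    also have "\<dots> = f \<otimes> (r \<otimes> b \<oplus> q \<otimes> y)"
      using d ab y f r by algebra
    finally show ?case using d ab y f r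
      by (intro bexI[of _ "r \<otimes> b \<oplus> q \<otimes> y"]) (auto simp: p_def q_def)
  qed
  from this[of k] obtain r where r: "r \<in> carrier R" "b [^] k = f \<otimes> r"
    unfolding k using ab by (auto simp: minus_eq)
  have "b [^] (k * i) = (f \<otimes> r) [^] i" using ab r by (simp flip: nat_pow_pow)
  also have "\<dots> = f [^] i \<otimes> r [^] i" using f r by (simp add: nat_pow_distrib)
  also have "\<dots> \<in> Idl {a}" by (rule A.I_r_closed) (use \<open>f [^] i \<in> Idl {a}\<close> r in auto)
  finally have "b [^] (k * i) \<in> Idl {a}" .
  moreover have "\<one> \<notin> Idl {a}"
    using one_not_in_M genideal_minimal[OF M_ideal, of "{a}"] ab(3) by blast
  \<comment> \<open>Regularity modulo \<open>a\<close> cancels one factor \<open>b\<close> at a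
    time, down to 1.\<close>
  moreover have "b [^] l \<in> Idl {a} \<Longrightarrow> \<one> \<in> Idl {a}" for l :: nat
  proof (induction l)
    case (Suc l)
    have "b [^] Suc l = b \<otimes> b [^] l" using ab by (simp add: m_comm)
    then show ?case using breg[of "b [^] l"] ab Suc by auto
  qed simp
  ultimately show False by blast
qed

lemma depth_eq_1: "depth R M = 1"
proof -
  have "enat 1 \<in> {enat (length xs) | xs. regular_sequence R xs \<and> set xs \<subseteq> M}"
    using regular_sequence_f f_in_M by force
  then show ?thesis using regular_sequence_length_le_1 unfolding depth_def one_enat_def
  proof (intro Sup_eqI, goal_cases)
    case (1 y)
    then show ?case by auto
  next
    case (2 y)
    then show ?case by meson
  qed
qed

theorem cohen_macaulay_local:
  "noetherian_ring R \<Longrightarrow> cohen_macaulay_local R"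
  unfolding cohen_macaulay_local_def
  using maximal_ideals is_cring by (metis depth_eq_1 krull_dim_eq_1)

end

section \<open>Localization\<close>

locale mult_subset = cring +
  fixes U
  assumes U_subset: "U \<subseteq> carrier R" and one_in_U: "\<one> \<in> U"
    and U_closed: "u \<in> U \<Longrightarrow> v \<in> U \<Longrightarrow> u \<otimes> v \<in> U"
begin

abbreviation L where "L \<equiv> localization R U"

definition frac where "frac a u = frac_rel R U `` {(a, u)}"

lemma U_carrier [simp]: "u \<in> U \<Longrightarrow> u \<in> carrier R"
  using U_subset by blast

text \<open>Without the subtraction, congruence of fractions becomes an equality of products, and
  the chains of rewriting below can be left to the \<open>algebra\<close> method.\<close>

lemma frac_rel_iff:
  "((a, u), (b, v)) \<in> frac_rel R U \<longleftrightarrow>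
     a \<in> carrier R \<and> b \<in> carrier R \<and> u \<in> U \<and> v \<in> U \<and> (\<exists>w\<in>U. w \<otimes> (v \<otimes> a) = w \<otimes> (u \<otimes> b))"
proof -
  have "w \<otimes> (v \<otimes> a \<ominus> u \<otimes> b) = \<zero> \<longleftrightarrow> w \<otimes> (v \<otimes> a) = w \<otimes> (u \<otimes> b)"
    if c: "a \<in> carrier R" "b \<in> carrier R" "u \<in> U" "v \<in> U" "w \<in> U" for w
  proof -
    have d: "u \<in> carrier R" "v \<in> carrier R" "w \<in> carrier R" using c by auto
    have eq: "w \<otimes> (v \<otimes> a \<ominus> u \<otimes> b) = w \<otimes> (v \<otimes> a) \<ominus> w \<otimes> (u \<otimes> b)"
      using c(1,2) d by algebra
    show ?thesis unfolding eq using c(1,2) d by (intro r_right_minus_eq) auto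
  qed
  then show ?thesis unfolding frac_rel_def by blast
qed

lemma frac_rel_equiv: "equiv (carrier R \<times> U) (frac_rel R U)"
proof (rule equivI)
  show "frac_rel R U \<subseteq> (carrier R \<times> U) \<times> (carrier R \<times> U)"
    unfolding frac_rel_def by blast
  show "refl_on (carrier R \<times> U) (frac_rel R U)"
    using one_in_U by (auto simp: refl_on_def frac_rel_iff)
  show "sym (frac_rel R U)"
  proof (rule symI, clarify)
    fix a u b v assume "((a, u), (b, v)) \<in> frac_rel R U"
    then show "((b, v), (a, u)) \<in> frac_rel R U"
      unfolding frac_rel_iff by metis
  qed
  show "trans (frac_rel R U)"
  proof (rule transI, clarify)
    fix a u b v c t assume "((a, u), (b, v)) \<in> frac_rel R U" "((b, v), (c, t)) \<in> frac_rel R U"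
    then obtain w w' where *: "a \<in> carrier R" "b \<in> carrier R" "c \<in> carrier R"
      "u \<in> U" "v \<in> U" "t \<in> U" "w \<in> U" "w' \<in> U"
      "w \<otimes> (v \<otimes> a) = w \<otimes> (u \<otimes> b)" "w' \<otimes> (t \<otimes> b) = w' \<otimes> (v \<otimes> c)"
      unfolding frac_rel_iff by blast
    then have c: "u \<in> carrier R" "v \<in> carrier R" "t \<in> carrier R" "w \<in> carrier R" "w' \<in> carrier R"
      by auto
    have "(w \<otimes> (w' \<otimes> v)) \<otimes> (t \<otimes> a) = (w' \<otimes> t) \<otimes> (w \<otimes> (v \<otimes> a))"
      using *(1-3) c by algebra
    also have "\<dots> = (w \<otimes> u) \<otimes> (w' \<otimes> (t \<otimes> b))"
      unfolding *(9) using *(1-3) c by algebra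
    also have "\<dots> = (w \<otimes> (w' \<otimes> v)) \<otimes> (u \<otimes> c)"
      unfolding *(10) using *(1-3) c by algebra
    finally show "((a, u), (c, t)) \<in> frac_rel R U"
      unfolding frac_rel_iff using * U_closed by blast
  qed
qed

lemma frac_eq_iff:
  assumes "a \<in> carrier R" "b \<in> carrier R" "u \<in> U" "v \<in> U"
  shows "frac a u = frac b v \<longleftrightarrow> (\<exists>w\<in>U. w \<otimes> (v \<otimes> a) = w \<otimes> (u \<otimes> b))"
  unfolding frac_def
  using eq_equiv_class_iff[OF frac_rel_equiv, of "(a, u)" "(b, v)"] assms
  by (simp add: frac_rel_iff)

lemma frac_eqI:
  assumes "a \<in> carrier R" "b \<in> carrier R" "u \<in> U" "v \<in> U" "v \<otimes> a = u \<otimes> b"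
  shows "frac a u = frac b v"
  using assms one_in_U by (subst frac_eq_iff) auto

lemma carrier_L: "carrier L = {frac a u | a u. a \<in> carrier R \<and> u \<in> U}"
  by (auto simp: localization_def quotient_def frac_def)

lemma frac_closed [simp]: "a \<in> carrier R \<Longrightarrow> u \<in> U \<Longrightarrow> frac a u \<in> carrier L"
  unfolding carrier_L by blast

lemma carrier_LE:
  assumes "x \<in> carrier L"
  obtains a u where "x = frac a u" "a \<in> carrier R" "u \<in> U"
  using assms unfolding carrier_L by blast

text \<open>The operations of \<open>localization\<close> are unions over all representatives of the
  two classes. If the value \<open>F\<close> does not depend on the representatives, the union
  collapses to a single one.\<close>

lemma UN_frac:
  assumes ab: "a \<in> carrier R" "b \<in> carrier R" "u \<in> U" "v \<in> U"
    and cong: "\<And>a' u' b' v'. ((a, u), (a', u')) \<in> frac_rel R U \<Longrightarrow> ((b, v), (b', v')) \<in> frac_rel R U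
                 \<Longrightarrow> F a' u' b' v' = F a u b v"
  shows "(\<Union>(a', u')\<in>frac a u. \<Union>(b', v')\<in>frac b v. F a' u' b' v') = F a u b v"
proof -
  have mem: "(a, u) \<in> frac a u" "(b, v) \<in> frac b v"
    using ab one_in_U by (auto simp: frac_def frac_rel_iff)
  have "F a' u' b' v' = F a u b v" if "(a', u') \<in> frac a u" "(b', v') \<in> frac b v" for a' u' b' v'
    using that cong unfolding frac_def by blast
  then have "(\<Union>(a', u')\<in>frac a u. \<Union>(b', v')\<in>frac b v. F a' u' b' v')
    = (\<Union>(a', u')\<in>frac a u. \<Union>(b', v')\<in>frac b v. F a u b v)"
    by (intro SUP_cong refl) auto
  then show ?thesis using mem by auto
qed

lemma frac_mult:
  assumes ab: "a \<in> carrier R" "b \<in> carrier R" "u \<in> U" "v \<in> U"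
  shows "frac a u \<otimes>\<^bsub>L\<^esub> frac b v = frac (a \<otimes> b) (u \<otimes> v)"
proof -
  have "frac_rel R U `` {(a' \<otimes> b', u' \<otimes> v')} = frac_rel R U `` {(a \<otimes> b, u \<otimes> v)}"
    if rel: "((a, u), (a', u')) \<in> frac_rel R U" "((b, v), (b', v')) \<in> frac_rel R U" for a' u' b' v'
  proof -
    from rel obtain w w' where *: "a' \<in> carrier R" "b' \<in> carrier R" "u' \<in> U" "v' \<in> U" "w \<in> U" "w' \<in> U"
      "w \<otimes> (u' \<otimes> a) = w \<otimes> (u \<otimes> a')" "w' \<otimes> (v' \<otimes> b) = w' \<otimes> (v \<otimes> b')"
      unfolding frac_rel_iff by blast
    then have c: "u \<in> carrier R" "v \<in> carrier R" "u' \<in> carrier R" "v' \<in> carrier R" "w \<in> carrier R" "w' \<in> carrier R"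
      using ab by auto
    have "(w \<otimes> w') \<otimes> ((u \<otimes> v) \<otimes> (a' \<otimes> b')) = (w \<otimes> (u \<otimes> a')) \<otimes> (w' \<otimes> (v \<otimes> b'))"
      using *(1,2) c ab(1,2) by algebra
    also have "\<dots> = (w \<otimes> w') \<otimes> ((u' \<otimes> v') \<otimes> (a \<otimes> b))"
      unfolding *(7,8)[symmetric] using *(1,2) c ab(1,2) by algebra
    finally show ?thesis
      using * ab U_closed by (fold frac_def, subst frac_eq_iff) auto
  qed
  then show ?thesis
    using UN_frac[OF ab, of "\<lambda>a u b v. frac_rel R U `` {(a \<otimes> b, u \<otimes> v)}"]
    by (simp add: localization_def frac_def)
qed

lemma frac_add:
  assumes ab: "a \<in> carrier R" "b \<in> carrier R" "u \<in> U" "v \<in> U"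
  shows "frac a u \<oplus>\<^bsub>L\<^esub> frac b v = frac (v \<otimes> a \<oplus> u \<otimes> b) (u \<otimes> v)"
proof -
  have "frac_rel R U `` {(v' \<otimes> a' \<oplus> u' \<otimes> b', u' \<otimes> v')} = frac_rel R U `` {(v \<otimes> a \<oplus> u \<otimes> b, u \<otimes> v)}"
    if rel: "((a, u), (a', u')) \<in> frac_rel R U" "((b, v), (b', v')) \<in> frac_rel R U" for a' u' b' v'
  proof -
    from rel obtain w w' where *: "a' \<in> carrier R" "b' \<in> carrier R" "u' \<in> U" "v' \<in> U" "w \<in> U" "w' \<in> U"
      "w \<otimes> (u' \<otimes> a) = w \<otimes> (u \<otimes> a')" "w' \<otimes> (v' \<otimes> b) = w' \<otimes> (v \<otimes> b')"
      unfolding frac_rel_iff by blast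
    then have c: "u \<in> carrier R" "v \<in> carrier R" "u' \<in> carrier R" "v' \<in> carrier R" "w \<in> carrier R" "w' \<in> carrier R"
      using ab by auto
    have "(w \<otimes> w') \<otimes> ((u \<otimes> v) \<otimes> (v' \<otimes> a' \<oplus> u' \<otimes> b'))
      = (w' \<otimes> (v \<otimes> v')) \<otimes> (w \<otimes> (u \<otimes> a')) \<oplus> (w \<otimes> (u \<otimes> u')) \<otimes> (w' \<otimes> (v \<otimes> b'))"
      using *(1,2) c ab(1,2) by algebra
    also have "\<dots> = (w \<otimes> w') \<otimes> ((u' \<otimes> v') \<otimes> (v \<otimes> a \<oplus> u \<otimes> b))"
      unfolding *(7,8)[symmetric] using *(1,2) c ab(1,2) by algebra
    finally show ?thesis
      using * c ab U_closed by (fold frac_def, subst frac_eq_iff) auto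
  qed
  then show ?thesis
    using UN_frac[OF ab, of "\<lambda>a u b v. frac_rel R U `` {(v \<otimes> a \<oplus> u \<otimes> b, u \<otimes> v)}"]
    by (simp add: localization_def frac_def)
qed

lemma one_L: "\<one>\<^bsub>L\<^esub> = frac \<one> \<one>"
  by (simp add: localization_def frac_def)

lemma zero_L: "\<zero>\<^bsub>L\<^esub> = frac \<zero> \<one>"
  by (simp add: localization_def frac_def)

lemma frac_zero: "u \<in> U \<Longrightarrow> frac \<zero> u = \<zero>\<^bsub>L\<^esub>"
  unfolding zero_L using one_in_U by (intro frac_eqI) auto

lemma frac_self: "u \<in> U \<Longrightarrow> frac u u = \<one>\<^bsub>L\<^esub>"
  unfolding one_L using one_in_U by (intro frac_eqI) auto

lemma frac_eq_zero_iff: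
  assumes "a \<in> carrier R" "u \<in> U"
  shows "frac a u = \<zero>\<^bsub>L\<^esub> \<longleftrightarrow> (\<exists>w\<in>U. w \<otimes> a = \<zero>)"
  unfolding zero_L using assms one_in_U by (subst frac_eq_iff) auto

lemma L_cring: "cring L"
proof (intro cringI abelian_groupI comm_monoidI)
  fix x y assume "x \<in> carrier L" "y \<in> carrier L"
  then obtain a u b v where xy: "x = frac a u" "a \<in> carrier R" "u \<in> U" "y = frac b v" "b \<in> carrier R" "v \<in> U"
    by (elim carrier_LE)
  then have c: "u \<in> carrier R" "v \<in> carrier R" "u \<otimes> v \<in> U" "v \<otimes> u \<in> U" using U_closed by auto
  show "x \<oplus>\<^bsub>L\<^esub> y \<in> carrier L" using xy c by (simp add: frac_add)
  show "x \<otimes>\<^bsub>L\<^esub> y \<in> carrier L" using xy c by (simp add: frac_mult)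
  show "x \<oplus>\<^bsub>L\<^esub> y = y \<oplus>\<^bsub>L\<^esub> x" using xy c
    by (simp add: frac_add, simp add: m_comm add.m_comm)
  show "x \<otimes>\<^bsub>L\<^esub> y = y \<otimes>\<^bsub>L\<^esub> x" using xy c by (simp add: frac_mult, simp add: m_comm)
next
  fix x y z assume "x \<in> carrier L" "y \<in> carrier L" "z \<in> carrier L"
  then obtain a u b v d t where xy: "x = frac a u" "a \<in> carrier R" "u \<in> U"
    "y = frac b v" "b \<in> carrier R" "v \<in> U" "z = frac d t" "d \<in> carrier R" "t \<in> U"
    by (elim carrier_LE)
  then have c: "u \<in> carrier R" "v \<in> carrier R" "t \<in> carrier R"
    "u \<otimes> v \<in> U" "v \<otimes> t \<in> U" "u \<otimes> t \<in> U" "u \<otimes> (v \<otimes> t) \<in> U" "u \<otimes> v \<otimes> t \<in> U" "u \<otimes> t \<otimes> (v \<otimes> t) \<in> U"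
    using U_closed by auto
  show "x \<oplus>\<^bsub>L\<^esub> y \<oplus>\<^bsub>L\<^esub> z = x \<oplus>\<^bsub>L\<^esub> (y \<oplus>\<^bsub>L\<^esub> z)"
  proof -
    have "(u \<otimes> (v \<otimes> t)) \<otimes> (t \<otimes> (v \<otimes> a \<oplus> u \<otimes> b) \<oplus> u \<otimes> v \<otimes> d)
      = (u \<otimes> v \<otimes> t) \<otimes> (v \<otimes> t \<otimes> a \<oplus> u \<otimes> (t \<otimes> b \<oplus> v \<otimes> d))"
      using c(1-3) xy(2,5,8) by algebra
    then have "frac (t \<otimes> (v \<otimes> a \<oplus> u \<otimes> b) \<oplus> u \<otimes> v \<otimes> d) (u \<otimes> v \<otimes> t)
      = frac (v \<otimes> t \<otimes> a \<oplus> u \<otimes> (t \<otimes> b \<oplus> v \<otimes> d)) (u \<otimes> (v \<otimes> t))"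
      using xy c by (intro frac_eqI) auto
    then show ?thesis using xy c by (simp add: frac_add)
  qed
  show "x \<otimes>\<^bsub>L\<^esub> y \<otimes>\<^bsub>L\<^esub> z = x \<otimes>\<^bsub>L\<^esub> (y \<otimes>\<^bsub>L\<^esub> z)"
    using xy c by (simp add: frac_mult m_assoc)
  show "(x \<oplus>\<^bsub>L\<^esub> y) \<otimes>\<^bsub>L\<^esub> z = x \<otimes>\<^bsub>L\<^esub> z \<oplus>\<^bsub>L\<^esub> y \<otimes>\<^bsub>L\<^esub> z"
  proof -
    have "(u \<otimes> t \<otimes> (v \<otimes> t)) \<otimes> ((v \<otimes> a \<oplus> u \<otimes> b) \<otimes> d)
      = (u \<otimes> v \<otimes> t) \<otimes> (v \<otimes> t \<otimes> (a \<otimes> d) \<oplus> u \<otimes> t \<otimes> (b \<otimes> d))"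
      using c(1-3) xy(2,5,8) by algebra
    then have "frac ((v \<otimes> a \<oplus> u \<otimes> b) \<otimes> d) (u \<otimes> v \<otimes> t)
      = frac (v \<otimes> t \<otimes> (a \<otimes> d) \<oplus> u \<otimes> t \<otimes> (b \<otimes> d)) (u \<otimes> t \<otimes> (v \<otimes> t))"
      using xy c by (intro frac_eqI) auto
    then show ?thesis using xy c by (simp add: frac_add frac_mult)
  qed
next
  fix x assume "x \<in> carrier L"
  then obtain a u where x: "x = frac a u" "a \<in> carrier R" "u \<in> U" by (elim carrier_LE)
  show "\<zero>\<^bsub>L\<^esub> \<oplus>\<^bsub>L\<^esub> x = x" using x one_in_U by (simp add: zero_L frac_add)
  show "\<one>\<^bsub>L\<^esub> \<otimes>\<^bsub>L\<^esub> x = x" using x one_in_U by (simp add: one_L frac_mult)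
  have "u \<otimes> (\<ominus> a) \<oplus> u \<otimes> a = \<zero>" using x U_carrier[OF x(3)] by algebra
  then have "frac (\<ominus> a) u \<oplus>\<^bsub>L\<^esub> x = \<zero>\<^bsub>L\<^esub>" using x U_closed by (simp add: frac_add frac_zero)
  then show "\<exists>y\<in>carrier L. y \<oplus>\<^bsub>L\<^esub> x = \<zero>\<^bsub>L\<^esub>" using x by (intro bexI[of _ "frac (\<ominus> a) u"]) auto
qed (use one_in_U in \<open>auto simp: zero_L one_L\<close>)

sublocale L: cring L by (rule L_cring)

lemma frac_pow:
  assumes "a \<in> carrier R" "u \<in> U"
  shows "frac a u [^]\<^bsub>L\<^esub> (k::nat) = frac (a [^] k) (u [^] k) \<and> u [^] k \<in> U"
  using assms one_in_U U_closed by (induction k) (auto simp: one_L frac_mult)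

lemma frac_minus:
  assumes "a \<in> carrier R" "b \<in> carrier R" "u \<in> U"
  shows "frac a u \<ominus>\<^bsub>L\<^esub> frac b u = frac (a \<ominus> b) u"
proof -
  have d: "u \<in> carrier R" using assms by simp
  have "frac (a \<ominus> b) u \<oplus>\<^bsub>L\<^esub> frac b u = frac (u \<otimes> (a \<ominus> b) \<oplus> u \<otimes> b) (u \<otimes> u)"
    using assms by (simp add: frac_add)
  also have "\<dots> = frac a u"
  proof (rule frac_eqI)
    show "u \<otimes> (u \<otimes> (a \<ominus> b) \<oplus> u \<otimes> b) = u \<otimes> u \<otimes> a" using assms(1,2) d by algebra
  qed (use assms U_closed in auto)
  finally have eq: "frac (a \<ominus> b) u \<oplus>\<^bsub>L\<^esub> frac b u = frac a u" .
  show ?thesis unfolding eq[symmetric] using assms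
    by (simp add: L.minus_eq L.a_assoc L.r_neg)
qed

lemma frac_ideal:
  assumes "ideal J R"
  shows "ideal {frac a u | a u. a \<in> J \<and> u \<in> U} L"
proof -
  interpret J: ideal J R by fact
  have mult: "\<exists>a' u'. y \<otimes>\<^bsub>L\<^esub> frac a u = frac a' u' \<and> a' \<in> J \<and> u' \<in> U"
    if "a \<in> J" "u \<in> U" "y \<in> carrier L" for a u y
  proof -
    from that obtain b v where y: "y = frac b v" "b \<in> carrier R" "v \<in> U" by (elim carrier_LE)
    then have "y \<otimes>\<^bsub>L\<^esub> frac a u = frac (b \<otimes> a) (v \<otimes> u)" using that J.Icarr by (simp add: frac_mult)
    moreover have "b \<otimes> a \<in> J" "v \<otimes> u \<in> U" using that y U_closed J.I_l_closed by auto
    ultimately show ?thesis by blast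
  qed
  have add: "\<exists>a' u'. frac a u \<oplus>\<^bsub>L\<^esub> frac b v = frac a' u' \<and> a' \<in> J \<and> u' \<in> U"
    if "a \<in> J" "u \<in> U" "b \<in> J" "v \<in> U" for a u b v
  proof -
    have "frac a u \<oplus>\<^bsub>L\<^esub> frac b v = frac (v \<otimes> a \<oplus> u \<otimes> b) (u \<otimes> v)" using that J.Icarr by (simp add: frac_add)
    moreover have "v \<otimes> a \<oplus> u \<otimes> b \<in> J" "u \<otimes> v \<in> U" using that U_closed J.I_l_closed by auto
    ultimately show ?thesis by blast
  qed
  let ?I = "{frac a u | a u. a \<in> J \<and> u \<in> U}"
  have sub: "?I \<subseteq> carrier L" using J.Icarr by auto
  show ?thesis
  proof (intro idealI L.ring_axioms L.add.subgroupI sub, goal_cases)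
    case 1
    then show ?case using J.zero_closed one_in_U by blast
  next
    case (2 x)
    then have "\<ominus>\<^bsub>L\<^esub> x = (\<ominus>\<^bsub>L\<^esub> \<one>\<^bsub>L\<^esub>) \<otimes>\<^bsub>L\<^esub> x" using sub by (simp add: L.l_minus subset_eq)
    then show ?case using 2 mult[of _ _ "\<ominus>\<^bsub>L\<^esub> \<one>\<^bsub>L\<^esub>"] by (fastforce simp flip: a_inv_def)
  next
    case (3 x y)
    then show ?case using add by fastforce
  next
    case (4 x y)
    then show ?case using mult by fastforce
  next
    case (5 x y)
    then have "x \<otimes>\<^bsub>L\<^esub> y = y \<otimes>\<^bsub>L\<^esub> x" using sub L.m_comm by blast
    then show ?case using 5 mult by fastforce
  qed
qed

text \<open>Numerators suffice: an ideal \<open>J\<close> of the localization is generated by the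
  images of generators of its contraction, because a / u is a multiple of a / 1 and
  conversely.\<close>

lemma frac_noetherian:
  assumes "noetherian_ring R"
  shows "noetherian_ring L"
proof (rule L.noetherian_ringI)
  fix J assume "ideal J L"
  then interpret J: ideal J L .
  have f1: "frac a \<one> \<otimes>\<^bsub>L\<^esub> frac b \<one> = frac (a \<otimes> b) \<one>" "frac a \<one> \<oplus>\<^bsub>L\<^esub> frac b \<one> = frac (a \<oplus> b) \<one>"
    if "a \<in> carrier R" "b \<in> carrier R" for a b
    using that one_in_U by (simp_all add: frac_mult frac_add)
  have contr: "ideal {a \<in> carrier R. frac a \<one> \<in> K} R" if K: "ideal K L" for K
  proof -
    interpret K: ideal K L by fact
    have mult: "frac (a \<otimes> r) \<one> \<in> K" if "a \<in> carrier R" "r \<in> carrier R" "frac a \<one> \<in> K" for a r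
      using K.I_r_closed[of "frac a \<one>" "frac r \<one>"] that one_in_U by (simp add: f1)
    show ?thesis
    proof (intro idealI ring_axioms add.subgroupI, goal_cases)
      case 2
      then show ?case using K.zero_closed by (auto simp: zero_L)
    next
      case (3 a)
      then show ?case using mult[of a "\<ominus> \<one>"] by (auto simp: r_minus simp flip: a_inv_def)
    next
      case (4 a b)
      then show ?case using K.a_closed[of "frac a \<one>" "frac b \<one>"] by (auto simp: f1)
    next
      case (5 a r)
      then show ?case using mult[of a r] by (auto simp: m_comm)
    next
      case (6 a r)
      then show ?case using mult[of a r] by auto
    qed auto
  qed
  obtain A where A: "A \<subseteq> carrier R" "finite A" "{a \<in> carrier R. frac a \<one> \<in> J} = Idl A"
    using noetherian_ring.finetely_gen[OF assms contr[OF J.is_ideal]] by blast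
  let ?B = "(\<lambda>a. frac a \<one>) ` A"
  have B: "?B \<subseteq> carrier L" using A(1) one_in_U by auto
  have "?B \<subseteq> J" using A(3) genideal_self[OF A(1)] by blast
  then have "Idl\<^bsub>L\<^esub> ?B \<subseteq> J" using L.genideal_minimal J.is_ideal by blast
  moreover have "J \<subseteq> Idl\<^bsub>L\<^esub> ?B"
  proof
    fix x assume x: "x \<in> J"
    then obtain a u where au: "x = frac a u" "a \<in> carrier R" "u \<in> U" using J.Icarr carrier_LE by metis
    have a_eq: "frac a \<one> = frac u \<one> \<otimes>\<^bsub>L\<^esub> x"
      unfolding au(1) using au one_in_U by (simp add: frac_mult, intro frac_eqI) auto
    then have "frac a \<one> \<in> J" using J.I_l_closed[OF x, of "frac u \<one>"] au one_in_U by simp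
    then have "a \<in> Idl A" using A(3) au by blast
    moreover have B_ideal: "ideal (Idl\<^bsub>L\<^esub> ?B) L" by (rule L.genideal_ideal[OF B])
    have "Idl A \<subseteq> {a \<in> carrier R. frac a \<one> \<in> Idl\<^bsub>L\<^esub> ?B}"
      using A(1) L.genideal_self[OF B] by (intro genideal_minimal contr B_ideal) auto
    ultimately have "frac a \<one> \<in> Idl\<^bsub>L\<^esub> ?B" by blast
    then have "frac \<one> u \<otimes>\<^bsub>L\<^esub> frac a \<one> \<in> Idl\<^bsub>L\<^esub> ?B"
      using au by (intro ideal.I_l_closed[OF B_ideal]) auto
    also have "frac \<one> u \<otimes>\<^bsub>L\<^esub> frac a \<one> = x"
      unfolding au(1) using au one_in_U by (simp add: frac_mult)
    finally show "x \<in> Idl\<^bsub>L\<^esub> ?B" .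
  qed
  ultimately show "\<exists>A\<subseteq>carrier L. finite A \<and> J = Idl\<^bsub>L\<^esub> A"
    using A(2) B by (intro exI[of _ ?B]) auto
qed

end

section \<open>Finite algebras over a polynomial ring in one variable\<close>

definition poly_submodule :: "('a, 'b) ring_scheme \<Rightarrow> ('k::field poly \<Rightarrow> 'a) \<Rightarrow> 'a set \<Rightarrow> bool" where
  "poly_submodule R \<phi> K \<longleftrightarrow> K \<subseteq> carrier R \<and> \<zero>\<^bsub>R\<^esub> \<in> K \<and>
     (\<forall>x\<in>K. \<forall>y\<in>K. x \<oplus>\<^bsub>R\<^esub> y \<in> K) \<and> (\<forall>p. \<forall>x\<in>K. \<phi> p \<otimes>\<^bsub>R\<^esub> x \<in> K)"

text \<open>A ring that is a finite module over k[x] through \<open>\<phi>\<close>. That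
  \<open>W\<close> generates the module is phrased as: no proper submodule contains
  \<open>W\<close>. This form needs no linear combinations and is easy to transport and to check by
  induction. Constant polynomials provide the scalars from the field.\<close>

locale poly_algebra = cring +
  fixes \<phi> :: "'k::field poly \<Rightarrow> 'a"
  assumes phi_closed [simp]: "\<phi> p \<in> carrier R"
    and phi_add: "\<phi> (p + q) = \<phi> p \<oplus> \<phi> q"
    and phi_mult: "\<phi> (p * q) = \<phi> p \<otimes> \<phi> q"
    and phi_one: "\<phi> 1 = \<one>"
    and finite_generated: "\<exists>W. finite W \<and> W \<subseteq> carrier R \<and>
          (\<forall>K. poly_submodule R \<phi> K \<longrightarrow> W \<subseteq> K \<longrightarrow> carrier R \<subseteq> K)"
begin

lemma phi_zero: "\<phi> 0 = \<zero>"
proof -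
  have "\<phi> 0 \<oplus> \<phi> 0 = \<phi> 0" by (simp flip: phi_add)
  then show ?thesis using add.l_cancel_one by simp
qed

lemma phi_uminus: "\<phi> (- p) = \<ominus> \<phi> p"
proof -
  have "\<phi> (- p) \<oplus> \<phi> p = \<zero>" by (simp add: phi_zero flip: phi_add)
  then show ?thesis using minus_equality by simp
qed

fun poly_span :: "'a list \<Rightarrow> 'a set" where
  "poly_span [] = {\<zero>}"
| "poly_span (w # ws) = {\<phi> p \<otimes> w \<oplus> r | p r. r \<in> poly_span ws}"

lemma poly_span_submodule: "set ws \<subseteq> carrier R \<Longrightarrow> poly_submodule R \<phi> (poly_span ws)"
proof (induction ws)
  case Nil
  then show ?case by (auto simp: poly_submodule_def)
next
  case (Cons w ws)
  then have S: "poly_submodule R \<phi> (poly_span ws)" and w: "w \<in> carrier R" by auto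
  note S = S[unfolded poly_submodule_def]
  have carr: "r \<in> carrier R" if "r \<in> poly_span ws" for r using S that by blast
  have 1: "\<exists>p' r''. (\<phi> p \<otimes> w \<oplus> r) \<oplus> (\<phi> q \<otimes> w \<oplus> r') = \<phi> p' \<otimes> w \<oplus> r'' \<and> r'' \<in> poly_span ws"
    if "r \<in> poly_span ws" "r' \<in> poly_span ws" for p q r r'
  proof (intro exI conjI)
    show "r \<oplus> r' \<in> poly_span ws" using S that by blast
    show "(\<phi> p \<otimes> w \<oplus> r) \<oplus> (\<phi> q \<otimes> w \<oplus> r') = \<phi> (p + q) \<otimes> w \<oplus> (r \<oplus> r')"
      unfolding phi_add using that[THEN carr] w phi_closed[of p] phi_closed[of q] by algebra
  qed
  have 2: "\<exists>p' r''. \<phi> q \<otimes> (\<phi> p \<otimes> w \<oplus> r) = \<phi> p' \<otimes> w \<oplus> r'' \<and> r'' \<in> poly_span ws"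
    if "r \<in> poly_span ws" for p q r
  proof (intro exI conjI)
    show "\<phi> q \<otimes> r \<in> poly_span ws" using S that by blast
    show "\<phi> q \<otimes> (\<phi> p \<otimes> w \<oplus> r) = \<phi> (q * p) \<otimes> w \<oplus> \<phi> q \<otimes> r"
      unfolding phi_mult using that[THEN carr] w phi_closed[of p] phi_closed[of q] by algebra
  qed
  have 3: "\<exists>p r. \<zero> = \<phi> p \<otimes> w \<oplus> r \<and> r \<in> poly_span ws"
    using S w by (intro exI[of _ 0] exI[of _ \<zero>]) (auto simp: phi_zero)
  show ?case unfolding poly_submodule_def using 1 2 3 w carr by fastforce
qed

lemma poly_span_superset: "set ws \<subseteq> carrier R \<Longrightarrow> set ws \<subseteq> poly_span ws"
proof (induction ws)
  case (Cons w ws)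
  then have S: "poly_submodule R \<phi> (poly_span ws)" and w: "w \<in> carrier R" by (auto intro: poly_span_submodule)
  note S = S[unfolded poly_submodule_def]
  have "w = \<phi> 1 \<otimes> w \<oplus> \<zero>" using w by (simp add: phi_one)
  then have "w \<in> poly_span (w # ws)" using S by force
  moreover have "x \<in> poly_span (w # ws)" if "x \<in> poly_span ws" for x
  proof -
    have "x = \<phi> 0 \<otimes> w \<oplus> x" using S that w by (auto simp: phi_zero)
    then show ?thesis using that by auto
  qed
  ultimately show ?case using Cons by auto
qed simp

text \<open>Submodules of finite modules over a principal ideal domain are finite, by induction on
  the number of generators. The possible coefficients of \<open>w\<close> in elements of
  \<open>J\<close> form the set \<open>P\<close>. One element \<open>z0\<close> of \<open>J\<close>
  whose coefficient has the least degree disposes of \<open>w\<close>, and what is left lies in the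
  span of the other generators. Representations need not be unique, so \<open>P\<close> collects the
  coefficients of all of them.\<close>

lemma submodule_finitely_generated:
  assumes "set ws \<subseteq> carrier R" "poly_submodule R \<phi> J" "J \<subseteq> poly_span ws"
  shows "\<exists>F\<subseteq>J. finite F \<and> (\<forall>K. poly_submodule R \<phi> K \<longrightarrow> F \<subseteq> K \<longrightarrow> J \<subseteq> K)"
  using assms
proof (induction ws arbitrary: J)
  case Nil
  then show ?case by (intro exI[of _ "{}"]) (auto simp: poly_submodule_def)
next
  case (Cons w ws)
  have w: "w \<in> carrier R" and ws: "set ws \<subseteq> carrier R" using Cons.prems by auto
  have S: "poly_submodule R \<phi> (poly_span ws)" using ws by (rule poly_span_submodule)
  have carr: "r \<in> carrier R" if "r \<in> poly_span ws" for r using S that unfolding poly_submodule_def by blast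
  define P where "P = {p. \<exists>r\<in>poly_span ws. \<phi> p \<otimes> w \<oplus> r \<in> J}"
  show ?case
  proof (cases "P \<subseteq> {0}")
    case True
    have "J \<subseteq> poly_span ws"
    proof
      fix z assume z: "z \<in> J"
      then obtain p r where pr: "z = \<phi> p \<otimes> w \<oplus> r" "r \<in> poly_span ws" using Cons.prems(3) by auto
      then have "p \<in> P" using z unfolding P_def by blast
      then have "p = 0" using True by blast
      then show "z \<in> poly_span ws" using pr carr w by (simp add: phi_zero)
    qed
    then show ?thesis using Cons.IH[OF ws Cons.prems(2)] by blast
  next
    case False
    then obtain p1 where p1: "p1 \<in> P \<and> p1 \<noteq> 0" by blast
    obtain p0 where p0: "p0 \<in> P" "p0 \<noteq> 0" and
      p0_min: "\<And>p. p \<in> P \<Longrightarrow> p \<noteq> 0 \<Longrightarrow> degree p0 \<le> degree p"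
      using ex_has_least_nat[of "\<lambda>p. p \<in> P \<and> p \<noteq> 0" p1 degree, OF p1] by blast
    obtain r0 where r0: "r0 \<in> poly_span ws" "\<phi> p0 \<otimes> w \<oplus> r0 \<in> J" using p0(1) unfolding P_def by blast
    define z0 where "z0 = \<phi> p0 \<otimes> w \<oplus> r0"
    have z0c: "z0 \<in> carrier R" using r0 carr w by (simp add: z0_def)
    have "poly_submodule R \<phi> (J \<inter> poly_span ws)"
      using S Cons.prems(2) unfolding poly_submodule_def by blast
    then obtain F where F: "F \<subseteq> J \<inter> poly_span ws" "finite F"
      "\<And>K. poly_submodule R \<phi> K \<Longrightarrow> F \<subseteq> K \<Longrightarrow> J \<inter> poly_span ws \<subseteq> K"
      using Cons.IH[OF ws _ Int_lower2] by meson
    have "J \<subseteq> K" if K: "poly_submodule R \<phi> K" "insert z0 F \<subseteq> K" for K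
    proof
      fix z assume z: "z \<in> J"
      then obtain p r where pr: "z = \<phi> p \<otimes> w \<oplus> r" "r \<in> poly_span ws" using Cons.prems(3) by auto
      \<comment> \<open>Division with remainder: subtracting \<open>q\<close> times
        \<open>z0\<close> leaves an element of \<open>J\<close> with coefficient
        \<open>p mod p0\<close>, which is 0 by the choice of \<open>p0\<close>.\<close>
      define q where "q = p div p0"
      define z' where "z' = z \<oplus> \<phi> (- q) \<otimes> z0"
      have z'J: "z' \<in> J" using z r0(2) Cons.prems(2) unfolding z'_def z0_def poly_submodule_def by simp
      define r' where "r' = r \<oplus> \<phi> (- q) \<otimes> r0"
      have r': "r' \<in> poly_span ws" using pr(2) r0(1) S unfolding r'_def poly_submodule_def by simp
      have "p mod p0 = p + (- q) * p0" by (simp add: q_def minus_mult_div_eq_mod flip: minus_div_mult_eq_mod)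
      then have mod: "\<phi> (p mod p0) = \<phi> p \<oplus> \<phi> (- q) \<otimes> \<phi> p0" by (simp only: phi_add phi_mult)
      have z': "z' = \<phi> (p mod p0) \<otimes> w \<oplus> r'"
        unfolding mod z'_def r'_def z0_def pr(1)
        using w carr[OF pr(2)] carr[OF r0(1)] phi_closed[of p] phi_closed[of "- q"] phi_closed[of p0] by algebra
      then have "p mod p0 \<in> P" using z'J r' unfolding P_def by blast
      then have "p mod p0 = 0" using p0_min[of "p mod p0"] degree_mod_less[OF p0(2), of p] by linarith
      then have "z' \<in> poly_span ws" using z' r' carr w by (simp add: phi_zero)
      then have "z' \<in> K" using F(3)[OF K(1)] K(2) z'J by blast
      moreover have "\<phi> q \<otimes> z0 \<in> K" using K unfolding poly_submodule_def by blast
      ultimately have "z' \<oplus> \<phi> q \<otimes> z0 \<in> K" using K unfolding poly_submodule_def by blast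
      also have "z' \<oplus> \<phi> q \<otimes> z0 = z"
      proof -
        have "z \<in> carrier R" using z Cons.prems(2) unfolding poly_submodule_def by blast
        then show ?thesis unfolding z'_def phi_uminus using z0c phi_closed[of q] by algebra
      qed
      finally show "z \<in> K" .
    qed
    then show ?thesis using F r0(2) unfolding z0_def[symmetric]
      by (intro exI[of _ "insert z0 F"]) auto
  qed
qed

lemma noetherian: "noetherian_ring R"
proof (rule noetherian_ringI)
  fix I assume I: "ideal I R"
  have sub: "poly_submodule R \<phi> K" if "ideal K R" for K
  proof -
    interpret K: ideal K R by fact
    show ?thesis using K.a_subset K.zero_closed K.a_closed K.I_l_closed
      unfolding poly_submodule_def by auto
  qed
  obtain W where W: "finite W" "W \<subseteq> carrier R"
    "\<And>K. poly_submodule R \<phi> K \<Longrightarrow> W \<subseteq> K \<Longrightarrow> carrier R \<subseteq> K"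
    using finite_generated by blast
  obtain ws where ws: "set ws = W" using finite_list W(1) by blast
  have "carrier R \<subseteq> poly_span ws"
    using W ws poly_span_submodule poly_span_superset by metis
  then have "I \<subseteq> poly_span ws" using additive_subgroup.a_subset[OF ideal.axioms(1)[OF I]] by blast
  then obtain F where F: "F \<subseteq> I" "finite F" "\<And>K. poly_submodule R \<phi> K \<Longrightarrow> F \<subseteq> K \<Longrightarrow> I \<subseteq> K"
    using submodule_finitely_generated[of ws I] ws W(2) sub[OF I] by blast
  have Fc: "F \<subseteq> carrier R" using F(1) additive_subgroup.a_subset[OF ideal.axioms(1)[OF I]] by blast
  have "I = Idl F"
    using F(3)[OF sub[OF genideal_ideal[OF Fc]] genideal_self[OF Fc]] genideal_minimal[OF I F(1)] by blast
  then show "\<exists>A\<subseteq>carrier R. finite A \<and> I = Idl A" using Fc F(2) by blast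
qed

end

text \<open>The hypotheses say that the ring is the sum of the image of k[x] and a nil ideal, and
  that it is torsion-free over k[x]. They are stable under isomorphism and imply the hypotheses of
  \<open>nil_uniformizer\<close> in every localization at a maximal ideal.\<close>

locale nil_extension = poly_algebra +
  fixes N
  assumes N_ideal: "ideal N R"
    and N_nil: "z \<in> N \<Longrightarrow> \<exists>k::nat. z [^] k = \<zero>"
    and N_decomp: "z \<in> carrier R \<Longrightarrow> \<exists>p. z \<ominus> \<phi> p \<in> N"
    and phi_regular: "p \<noteq> 0 \<Longrightarrow> z \<in> carrier R \<Longrightarrow> \<phi> p \<otimes> z = \<zero> \<Longrightarrow> z = \<zero>"
begin

context
  fixes M assumes M: "maximalideal M R"
begin

interpretation M: maximalideal M R by (rule M)
interpretation Mp: primeideal M R by (rule maximalideal_prime[OF M])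

lemma one_notin_maximal: "\<one> \<notin> M"
  using M.one_imp_carrier M.I_notcarr by blast

lemma nil_subset_maximal: "N \<subseteq> M"
proof
  fix z assume z: "z \<in> N"
  then obtain k :: nat where "z [^] k = \<zero>" using N_nil by blast
  then show "z \<in> M" using Mp.nat_pow_mem_imp[of z k] ideal.Icarr[OF N_ideal z] M.zero_closed by simp
qed

text \<open>If the image x of the variable is not in \<open>M\<close>, it is invertible modulo
  \<open>M\<close>. As \<open>N\<close> is contained in \<open>M\<close>, an inverse can be chosen
  of the form \<open>\<phi> p\<close>. Then 1 - x p is mapped into \<open>M\<close>, and it is
  nonzero because its constant term is 1.\<close>

lemma phi_in_maximal: "\<exists>p. p \<noteq> 0 \<and> \<phi> p \<in> M"
proof (cases "\<phi> [:0, 1:] \<in> M")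
  case True
  then show ?thesis by (intro exI[of _ "[:0, 1:]"]) auto
next
  case False
  define x where "x = \<phi> [:0, 1:]"
  have xc: "x \<in> carrier R" by (simp add: x_def)
  define J where "J = {z \<in> carrier R. \<exists>a\<in>carrier R. z \<ominus> x \<otimes> a \<in> M}"
  have J: "ideal J R" unfolding J_def by (rule ideal_add_principal[OF M.is_ideal xc])
  have "M \<subseteq> J"
  proof
    fix z assume z: "z \<in> M"
    then have "z \<ominus> x \<otimes> \<zero> = z" using xc M.Icarr[OF z] by algebra
    then show "z \<in> J" using z M.Icarr[OF z] zero_closed unfolding J_def by (metis (mono_tags, lifting) mem_Collect_eq)
  qed
  moreover have "x \<in> J"
  proof -
    have "x \<ominus> x \<otimes> \<one> = \<zero>" using xc by algebra
    then show ?thesis using xc M.zero_closed one_closed unfolding J_def by (metis (mono_tags, lifting) mem_Collect_eq)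
  qed
  moreover have "J \<subseteq> carrier R" by (auto simp: J_def)
  ultimately have "J = carrier R" using M.I_maximal[OF J] False unfolding x_def by blast
  then obtain a where a: "a \<in> carrier R" "\<one> \<ominus> x \<otimes> a \<in> M" unfolding J_def using one_closed by blast
  obtain p where p: "a \<ominus> \<phi> p \<in> N" using N_decomp a by blast
  then have pM: "a \<ominus> \<phi> p \<in> M" using nil_subset_maximal by blast
  have "\<phi> (1 + - ([:0, 1:] * p)) = \<one> \<oplus> \<ominus> (x \<otimes> \<phi> p)"
    by (simp only: phi_add phi_uminus phi_mult phi_one x_def)
  also have "\<dots> = (\<one> \<ominus> x \<otimes> a) \<oplus> x \<otimes> (a \<ominus> \<phi> p)" using a(1) xc phi_closed[of p] by algebra
  also have "\<dots> \<in> M" using a(2) M.I_l_closed[OF pM xc] by (rule M.a_closed)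
  finally have "\<phi> (1 + - ([:0, 1:] * p)) \<in> M" .
  moreover have "poly (1 + - ([:0, 1:] * p)) 0 \<noteq> 0" by simp
  then have "1 + - ([:0, 1:] * p) \<noteq> 0" by (metis poly_0)
  ultimately show ?thesis by blast
qed

text \<open>The contraction of \<open>M\<close> to k[x] is generated by an element \<open>p0\<close>
  of least degree, and \<open>f\<close> is its image. Up to \<open>N'\<close>, each element of the
  localization is the image of a polynomial over a unit.\<close>

lemma cohen_macaulay_local_localization: "cohen_macaulay_local (localization R (carrier R - M))"
proof -
  define U where "U = carrier R - M"
  interpret mult_subset R U
  proof
    show "\<one> \<in> U" using one_notin_maximal by (simp add: U_def)
    show "u \<otimes> v \<in> U" if "u \<in> U" "v \<in> U" for u v using that Mp.I_prime unfolding U_def by blast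
  qed (simp add: U_def)
  obtain p1 where p1: "p1 \<noteq> 0 \<and> \<phi> p1 \<in> M" using phi_in_maximal by blast
  obtain p0 where p0: "p0 \<noteq> 0" "\<phi> p0 \<in> M" and
    p0_min: "\<And>p. p \<noteq> 0 \<Longrightarrow> \<phi> p \<in> M \<Longrightarrow> degree p0 \<le> degree p"
    using ex_has_least_nat[of "\<lambda>p. p \<noteq> 0 \<and> \<phi> p \<in> M" p1 degree, OF p1] by blast
  have dvd: "p0 dvd p" if p: "\<phi> p \<in> M" for p
  proof -
    have "\<phi> (p mod p0) = \<phi> (p + (- (p div p0)) * p0)"
      by (simp add: minus_mult_div_eq_mod flip: minus_div_mult_eq_mod)
    also have "\<dots> = \<phi> p \<oplus> \<phi> (- (p div p0)) \<otimes> \<phi> p0" by (simp only: phi_add phi_mult)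
    also have "\<dots> \<in> M" using p M.I_l_closed[OF p0(2) phi_closed] by (rule M.a_closed)
    finally have "p mod p0 = 0" using p0_min[of "p mod p0"] degree_mod_less[OF p0(1), of p] by linarith
    then show ?thesis by (simp add: dvd_eq_mod_eq_0)
  qed
  have "degree p0 \<noteq> 0"
  proof
    assume "degree p0 = 0"
    then have "p0 dvd 1" using p0(1) is_unit_iff_degree by blast
    then obtain q where "1 = p0 * q" by blast
    then have "\<one> = \<phi> p0 \<otimes> \<phi> q" by (metis phi_mult phi_one)
    then show False using M.I_r_closed[OF p0(2) phi_closed[of q]] one_notin_maximal by simp
  qed
  \<comment> \<open>Splitting off all factors \<open>p0\<close> leaves a cofactor outside the
    contraction of \<open>M\<close>, that is, one that becomes a unit in the localization. This
    yields \<open>decomp\<close>.\<close>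
  have factor: "\<exists>j q. p = q * p0 ^ j \<and> \<phi> q \<notin> M" if "p \<noteq> 0" for p
    using that
  proof (induction "degree p" arbitrary: p rule: less_induct)
    case less
    show ?case
    proof (cases "\<phi> p \<in> M")
      case True
      then obtain q where q: "p = p0 * q" using dvd by blast
      then have "q \<noteq> 0" "degree q < degree p"
        using less.prems p0(1) \<open>degree p0 \<noteq> 0\<close> by (auto simp: degree_mult_eq)
      then obtain j q' where "q = q' * p0 ^ j" "\<phi> q' \<notin> M" using less.hyps by blast
      then show ?thesis using q by (intro exI[of _ "Suc j"] exI[of _ q']) (auto simp: mult_ac)
    next
      case False
      then show ?thesis by (intro exI[of _ 0] exI[of _ p]) auto
    qed
  qed
  have phi_pow: "\<phi> (q ^ j) = \<phi> q [^] j" for q and j :: nat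
    by (induction j) (simp_all add: phi_one phi_mult m_comm)
  define N' where "N' = {frac a u | a u. a \<in> N \<and> u \<in> U}"
  define f where "f = frac (\<phi> p0) \<one>"
  have Ncarr: "a \<in> carrier R" if "a \<in> N" for a using ideal.Icarr[OF N_ideal that] .
  interpret L: nil_uniformizer L N' f
  proof (rule nil_uniformizer.intro[OF L_cring nil_uniformizer_axioms.intro])
    show "ideal N' L" unfolding N'_def by (rule frac_ideal[OF N_ideal])
    show "\<exists>k::nat. z [^]\<^bsub>L\<^esub> k = \<zero>\<^bsub>L\<^esub>" if "z \<in> N'" for z
    proof -
      from that obtain a u where au: "z = frac a u" "a \<in> N" "u \<in> U" unfolding N'_def by blast
      then obtain k :: nat where k: "a [^] k = \<zero>" using N_nil by blast
      have "z [^]\<^bsub>L\<^esub> k = frac (a [^] k) (u [^] k)" "u [^] k \<in> U"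
        unfolding au(1) using frac_pow[of a u k] Ncarr au by auto
      then show ?thesis using k by (metis frac_zero)
    qed
    show "f \<in> carrier L" using one_in_U by (simp add: f_def)
    show "f \<notin> Units L"
    proof
      assume "f \<in> Units L"
      then obtain y where y: "y \<in> carrier L" "f \<otimes>\<^bsub>L\<^esub> y = \<one>\<^bsub>L\<^esub>" unfolding Units_def by blast
      then obtain b v where b: "y = frac b v" "b \<in> carrier R" "v \<in> U" by (elim carrier_LE)
      have "frac (\<phi> p0 \<otimes> b) v = frac \<one> \<one>"
        using y(2) b one_in_U by (simp add: f_def frac_mult one_L)
      then obtain w where w: "w \<in> U" "w \<otimes> (\<one> \<otimes> (\<phi> p0 \<otimes> b)) = w \<otimes> (v \<otimes> \<one>)"
        using b one_in_U by (subst (asm) frac_eq_iff) auto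
      have "\<one> \<otimes> (\<phi> p0 \<otimes> b) \<in> M" using M.I_r_closed[OF p0(2) b(2)] b by simp
      then have "w \<otimes> (v \<otimes> \<one>) \<in> M" unfolding w(2)[symmetric] using w(1) by (rule M.I_l_closed[OF _ U_carrier])
      moreover have "w \<otimes> (v \<otimes> \<one>) \<in> U" using w b by (simp add: U_closed)
      ultimately show False by (simp add: U_def)
    qed
    show "z = \<zero>\<^bsub>L\<^esub>" if z: "z \<in> carrier L" "f \<otimes>\<^bsub>L\<^esub> z = \<zero>\<^bsub>L\<^esub>" for z
    proof -
      obtain b v where b: "z = frac b v" "b \<in> carrier R" "v \<in> U" using z(1) by (elim carrier_LE)
      have "frac (\<phi> p0 \<otimes> b) v = \<zero>\<^bsub>L\<^esub>"
        using z(2) b one_in_U by (simp add: f_def frac_mult)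
      then obtain w where w: "w \<in> U" "w \<otimes> (\<phi> p0 \<otimes> b) = \<zero>" using b by (subst (asm) frac_eq_zero_iff) auto
      have "\<phi> p0 \<otimes> (w \<otimes> b) = w \<otimes> (\<phi> p0 \<otimes> b)" using w(1) b(2) by (simp add: m_lcomm)
      then have "w \<otimes> b = \<zero>" using phi_regular[OF p0(1), of "w \<otimes> b"] w b by simp
      then show ?thesis unfolding b(1) using b w by (subst frac_eq_zero_iff) auto
    qed
    show "\<exists>u\<in>Units L. \<exists>j::nat. z \<ominus>\<^bsub>L\<^esub> u \<otimes>\<^bsub>L\<^esub> f [^]\<^bsub>L\<^esub> j \<in> N'" if z: "z \<in> carrier L" "z \<notin> N'" for z
    proof -
      obtain a u where a: "z = frac a u" "a \<in> carrier R" "u \<in> U" using z(1) by (elim carrier_LE)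
      obtain p where p: "a \<ominus> \<phi> p \<in> N" using N_decomp a by blast
      have "a \<notin> N" using z(2) a unfolding N'_def by blast
      then have "p \<noteq> 0" using p a(2) by (auto simp: phi_zero minus_eq)
      then obtain j q where q: "p = q * p0 ^ j" "\<phi> q \<notin> M" using factor by blast
      have qU: "\<phi> q \<in> U" using q by (simp add: U_def)
      have fj: "f [^]\<^bsub>L\<^esub> j = frac (\<phi> p0 [^] j) \<one>"
        unfolding f_def using frac_pow[of "\<phi> p0" \<one> j] one_in_U by simp
      have "frac (\<phi> q) u \<otimes>\<^bsub>L\<^esub> f [^]\<^bsub>L\<^esub> j = frac (\<phi> p) u"
        using one_in_U a by (simp add: fj frac_mult q(1) phi_mult phi_pow)
      then have "z \<ominus>\<^bsub>L\<^esub> frac (\<phi> q) u \<otimes>\<^bsub>L\<^esub> f [^]\<^bsub>L\<^esub> j = frac (a \<ominus> \<phi> p) u"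
        using a by (simp add: frac_minus)
      also have "\<dots> \<in> N'" using p a unfolding N'_def by blast
      finally have mem: "z \<ominus>\<^bsub>L\<^esub> frac (\<phi> q) u \<otimes>\<^bsub>L\<^esub> f [^]\<^bsub>L\<^esub> j \<in> N'" .
      have "frac (\<phi> q) u \<otimes>\<^bsub>L\<^esub> frac u (\<phi> q) = \<one>\<^bsub>L\<^esub>"
        using a qU U_closed by (simp add: frac_mult m_comm frac_self)
      then have "frac (\<phi> q) u \<in> Units L"
        using L.divisor_of_Unit[of "frac (\<phi> q) u" "frac u (\<phi> q)"] a qU by simp
      then show ?thesis using mem by blast
    qed
  qed
  show ?thesis
    using L.cohen_macaulay_local frac_noetherian noetherian unfolding U_def by blast
qed

end

theorem cohen_macaulay: "cohen_macaulay R"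
  unfolding cohen_macaulay_def
  using is_cring noetherian cohen_macaulay_local_localization by blast

end

text \<open>The target \<open>G\<close> is not assumed to be a ring: its axioms are inherited along
  the bijection, which spares their verification for \<open>assoc_graded\<close>. Membership in
  \<open>ring_iso\<close> says nothing about zero, hence the separate condition
  \<open>h_zero\<close>.\<close>

lemma (in nil_extension) transport:
  assumes h: "h \<in> ring_iso R G" and h_zero: "h \<zero>\<^bsub>R\<^esub> = \<zero>\<^bsub>G\<^esub>"
  shows "nil_extension G (h \<circ> \<phi>) (h ` N)"
proof -
  have "cring (G \<lparr>zero := h \<zero>\<^bsub>R\<^esub>\<rparr>)" by (rule ring_iso_imp_img_cring[OF h])
  then interpret G: cring G by (simp add: h_zero)
  have hom: "h \<in> ring_hom R G" and bij: "bij_betw h (carrier R) (carrier G)"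
    using h by (auto simp: ring_iso_def)
  interpret h: ring_hom_cring R G h
    by unfold_locales (rule hom)
  have inj: "x = y" if "h x = h y" "x \<in> carrier R" "y \<in> carrier R" for x y
    using bij that unfolding bij_betw_def inj_on_def by blast
  have surj: "\<exists>x\<in>carrier R. y = h x" if "y \<in> carrier G" for y
    using bij that unfolding bij_betw_def by blast
  interpret N: ideal N R by (rule N_ideal)
  have minus: "h (x \<ominus>\<^bsub>R\<^esub> y) = h x \<ominus>\<^bsub>G\<^esub> h y" if "x \<in> carrier R" "y \<in> carrier R" for x y
    using that by (simp add: a_minus_def)
  have "ideal (h ` N) G"
  proof (intro idealI G.ring_axioms G.add.subgroupI, goal_cases)
    case 1
    then show ?case using N.Icarr by auto
  next
    case 2
    then show ?case using N.zero_closed by blast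
  next
    case (3 y)
    then obtain x where "y = h x" "x \<in> N" by blast
    then have "\<ominus>\<^bsub>G\<^esub> y = h (\<ominus>\<^bsub>R\<^esub> x)" "\<ominus>\<^bsub>R\<^esub> x \<in> N" using N.Icarr by auto
    then show ?case by (simp flip: a_inv_def)
  next
    case (4 y z)
    then obtain x x' where "y = h x" "x \<in> N" "z = h x'" "x' \<in> N" by blast
    then have "y \<oplus>\<^bsub>G\<^esub> z = h (x \<oplus>\<^bsub>R\<^esub> x')" "x \<oplus>\<^bsub>R\<^esub> x' \<in> N" using N.Icarr by auto
    then show ?case by simp
  next
    case (5 y z)
    then obtain x x' where "y = h x" "x \<in> N" "z = h x'" "x' \<in> carrier R" using surj by blast
    then have "z \<otimes>\<^bsub>G\<^esub> y = h (x' \<otimes>\<^bsub>R\<^esub> x)" "x' \<otimes>\<^bsub>R\<^esub> x \<in> N" using N.Icarr N.I_l_closed by auto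
    then show ?case by simp
  next
    case (6 y z)
    then obtain x x' where "y = h x" "x \<in> N" "z = h x'" "x' \<in> carrier R" using surj by blast
    then have "y \<otimes>\<^bsub>G\<^esub> z = h (x \<otimes>\<^bsub>R\<^esub> x')" "x \<otimes>\<^bsub>R\<^esub> x' \<in> N" using N.Icarr N.I_r_closed by auto
    then show ?case by simp
  qed
  moreover have "\<exists>k::nat. z [^]\<^bsub>G\<^esub> k = \<zero>\<^bsub>G\<^esub>" if "z \<in> h ` N" for z
  proof -
    from that obtain x where x: "z = h x" "x \<in> N" by blast
    obtain k :: nat where "x [^]\<^bsub>R\<^esub> k = \<zero>\<^bsub>R\<^esub>" using N_nil x by blast
    moreover have "h (x [^]\<^bsub>R\<^esub> k) = z [^]\<^bsub>G\<^esub> k" for k :: nat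
      using x N.Icarr by (induction k) auto
    ultimately have "z [^]\<^bsub>G\<^esub> k = \<zero>\<^bsub>G\<^esub>" using h_zero by metis
    then show ?thesis by blast
  qed
  moreover have "\<exists>p. z \<ominus>\<^bsub>G\<^esub> (h \<circ> \<phi>) p \<in> h ` N" if "z \<in> carrier G" for z
  proof -
    from surj[OF that] obtain x where x: "z = h x" "x \<in> carrier R" by blast
    obtain p where "x \<ominus>\<^bsub>R\<^esub> \<phi> p \<in> N" using N_decomp x by blast
    then have "h (x \<ominus>\<^bsub>R\<^esub> \<phi> p) \<in> h ` N" by blast
    then show ?thesis using x minus by (intro exI[of _ p]) simp
  qed
  moreover have "z = \<zero>\<^bsub>G\<^esub>" if z: "p \<noteq> 0" "z \<in> carrier G" "(h \<circ> \<phi>) p \<otimes>\<^bsub>G\<^esub> z = \<zero>\<^bsub>G\<^esub>" for p z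
  proof -
    from surj[OF z(2)] obtain x where x: "z = h x" "x \<in> carrier R" by blast
    then have "h (\<phi> p \<otimes>\<^bsub>R\<^esub> x) = h \<zero>\<^bsub>R\<^esub>" using z by simp
    then have "\<phi> p \<otimes>\<^bsub>R\<^esub> x = \<zero>\<^bsub>R\<^esub>" using inj x by simp
    then have "x = \<zero>\<^bsub>R\<^esub>" using phi_regular z(1) x(2) by blast
    then show ?thesis using x by simp
  qed
  moreover have fg: "\<exists>W. finite W \<and> W \<subseteq> carrier G \<and>
          (\<forall>K. poly_submodule G (h \<circ> \<phi>) K \<longrightarrow> W \<subseteq> K \<longrightarrow> carrier G \<subseteq> K)"
  proof -
    obtain W where W: "finite W" "W \<subseteq> carrier R"
      "\<And>K. poly_submodule R \<phi> K \<Longrightarrow> W \<subseteq> K \<Longrightarrow> carrier R \<subseteq> K"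
      using finite_generated by blast
    have "carrier G \<subseteq> K" if K: "poly_submodule G (h \<circ> \<phi>) K" "h ` W \<subseteq> K" for K
    proof -
      have "poly_submodule R \<phi> {x \<in> carrier R. h x \<in> K}"
        using K(1) unfolding poly_submodule_def by auto
      then have "carrier R \<subseteq> {x \<in> carrier R. h x \<in> K}" using W(2) K(2) by (intro W(3)) auto
      then show ?thesis using surj by blast
    qed
    then show ?thesis using W(1,2) by (intro exI[of _ "h ` W"]) auto
  qed
  moreover have "poly_algebra G (h \<circ> \<phi>)"
    using fg by unfold_locales (simp_all add: phi_add phi_mult phi_one)
  ultimately show ?thesis
    by (intro nil_extension.intro nil_extension_axioms.intro)
qed

section \<open>The order filtration of a semigroup\<close>

hide_const (open) up_ring.coeff up_ring.monom

text \<open>These are the exponents of the monomials in the powers I^k of the ideal generated by the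
  monomials of the minimal generators (\<open>ideal_power_eq\<close>), so that
  \<open>ord S x\<close> is the I-adic order of the monomial t^x for \<open>x\<close> in
  \<open>S\<close>.\<close>

fun lev :: "nat set \<Rightarrow> nat \<Rightarrow> nat set" where
  "lev S 0 = S"
| "lev S (Suc k) = {x + y | x y. x \<in> lev S k \<and> y \<in> S \<and> y \<noteq> 0}"

definition ord :: "nat set \<Rightarrow> nat \<Rightarrow> nat" where
  "ord S x = Max {k. x \<in> lev S k}"

locale submonoid_nat =
  fixes S :: "nat set"
  assumes zero_in: "0 \<in> S" and add_in: "x \<in> S \<Longrightarrow> y \<in> S \<Longrightarrow> x + y \<in> S"
begin

lemma lev_subset: "x \<in> lev S k \<Longrightarrow> x \<in> S"
  by (induction k arbitrary: x) (auto intro: add_in)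

lemma lev_Suc_subset: "x \<in> lev S (Suc k) \<Longrightarrow> x \<in> lev S k"
proof (induction k arbitrary: x)
  case 0
  then show ?case by (auto intro: add_in)
next
  case (Suc k)
  obtain a b where ab: "x = a + b" "a \<in> lev S (Suc k)" "b \<in> S" "b \<noteq> 0"
    using Suc.prems unfolding lev.simps(2)[of S "Suc k"] by blast
  have "a \<in> lev S k" using Suc.IH ab(2) .
  then show ?case unfolding lev.simps(2)[of S k] using ab by blast
qed

lemma lev_antimono: "x \<in> lev S k \<Longrightarrow> j \<le> k \<Longrightarrow> x \<in> lev S j"
  by (induction k) (use lev_Suc_subset in \<open>auto simp: le_Suc_eq simp del: lev.simps(2)\<close>)

lemma lev_add: "x \<in> lev S i \<Longrightarrow> y \<in> lev S j \<Longrightarrow> x + y \<in> lev S (i + j)"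
proof (induction j arbitrary: y)
  case 0
  then show ?case
  proof (induction i arbitrary: x)
    case (Suc i)
    then obtain a b where "x = a + b" "a \<in> lev S i" "b \<in> S" "b \<noteq> 0" by auto
    moreover have "a + y \<in> lev S i" using Suc calculation by auto
    ultimately have "x + y = (a + y) + b" "a + y \<in> lev S i" "b \<in> S" "b \<noteq> 0" by auto
    then show ?case by (simp, blast)
  qed (auto intro: add_in)
next
  case (Suc j)
  then obtain a b where "y = a + b" "a \<in> lev S j" "b \<in> S" "b \<noteq> 0" by auto
  moreover have "x + a \<in> lev S (i + j)" using Suc calculation by auto
  ultimately have "x + y = (x + a) + b" "x + a \<in> lev S (i + j)" "b \<in> S" "b \<noteq> 0" by auto
  then show ?case by (simp, blast)
qed

lemma lev_1: "lev S (Suc 0) = S - {0}"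
proof
  show "S - {0} \<subseteq> lev S (Suc 0)" using zero_in by force
qed (auto intro: add_in)

lemma lev_le: "x \<in> lev S k \<Longrightarrow> k \<le> x"
proof (induction k arbitrary: x)
  case (Suc k)
  then show ?case by fastforce
qed simp

lemma lev_iff:
  assumes "x \<in> S" shows "x \<in> lev S k \<longleftrightarrow> k \<le> ord S x"
proof -
  have fin: "finite {k. x \<in> lev S k}"
    by (rule finite_subset[of _ "{..x}"]) (blast dest: lev_le, simp)
  have "0 \<in> {k. x \<in> lev S k}" using assms by simp
  then have "ord S x \<in> {k. x \<in> lev S k}" unfolding ord_def by (intro Max_in fin) blast
  then have "x \<in> lev S (ord S x)" by blast
  then show ?thesis using lev_antimono[of x "ord S x" k] Max_ge[OF fin, of k] unfolding ord_def by blast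
qed

lemma ord_add: "x \<in> S \<Longrightarrow> y \<in> S \<Longrightarrow> ord S x + ord S y \<le> ord S (x + y)"
  using lev_add[of x "ord S x" y "ord S y"] by (simp add: lev_iff add_in)

lemma ord_0: "ord S 0 = 0"
  using lev_le[of 0 "ord S 0"] zero_in by (simp add: lev_iff)

definition ok where "ok i j \<longleftrightarrow> i \<in> S \<and> j \<in> S \<and> ord S (i + j) = ord S i + ord S j"

lemma ok_0 [simp]: "ok 0 i \<longleftrightarrow> i \<in> S"
  by (auto simp: ok_def zero_in ord_0)

lemma ok_commute: "ok i j \<longleftrightarrow> ok j i"
  by (auto simp: ok_def add.commute)

text \<open>As \<open>ord\<close> is superadditive, both sides say that the order of i + j + k is
  the sum of the three orders. This is the associativity of the truncated product.\<close>

lemma ok_assoc: "ok i j \<and> ok (i + j) k \<longleftrightarrow> ok j k \<and> ok i (j + k)"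
proof (cases "i \<in> S \<and> j \<in> S \<and> k \<in> S")
  case True
  then have "ord S (i + j) + ord S k \<le> ord S (i + j + k)" "ord S i + ord S j \<le> ord S (i + j)"
    "ord S i + ord S (j + k) \<le> ord S (i + j + k)" "ord S j + ord S k \<le> ord S (j + k)"
    using ord_add[of "i + j" k] ord_add[of i j] ord_add[of i "j + k"] ord_add[of j k] add_in
    by (simp_all add: add.assoc)
  then show ?thesis using True add_in unfolding ok_def add.assoc by (intro iffI conjI) simp_all
next
  case False
  then show ?thesis unfolding ok_def by blast
qed

end

section \<open>The monomial model of the associated graded ring\<close>

definition polys_on :: "nat set \<Rightarrow> 'k::field poly set" where
  "polys_on T = {p. \<forall>i. coeff p i \<noteq> 0 \<longrightarrow> i \<in> T}"

lemma polys_on_zero [simp]: "0 \<in> polys_on T"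
  by (simp add: polys_on_def)

lemma polys_on_add: "p \<in> polys_on T \<Longrightarrow> q \<in> polys_on T \<Longrightarrow> p + q \<in> polys_on T"
  by (auto simp: polys_on_def) (metis add.right_neutral)

lemma polys_on_uminus [simp]: "- p \<in> polys_on T \<longleftrightarrow> p \<in> polys_on T"
  by (auto simp: polys_on_def)

lemma polys_on_diff: "p \<in> polys_on T \<Longrightarrow> q \<in> polys_on T \<Longrightarrow> p - q \<in> polys_on T"
  using polys_on_add[of p T "- q"] by simp

lemma polys_on_monom: "i \<in> T \<Longrightarrow> monom c i \<in> polys_on T"
  by (auto simp: polys_on_def split: if_splits)

lemma polys_on_mult:
  assumes "p \<in> polys_on T" "q \<in> polys_on T'" "\<And>x y. x \<in> T \<Longrightarrow> y \<in> T' \<Longrightarrow> x + y \<in> T''"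
  shows "p * q \<in> polys_on T''"
  unfolding polys_on_def
proof (intro CollectI allI impI)
  fix n assume "coeff (p * q) n \<noteq> 0"
  then obtain i where "i \<le> n" "coeff p i * coeff q (n - i) \<noteq> 0"
    unfolding coeff_mult by (metis (no_types, lifting) atMost_iff sum.neutral)
  then show "n \<in> T''" using assms(1,2) assms(3)[of i "n - i"] by (auto simp: polys_on_def)
qed

lemma polys_on_mono: "T \<subseteq> T' \<Longrightarrow> polys_on T \<subseteq> polys_on T'"
  by (auto simp: polys_on_def)

lemma polys_on_induct:
  assumes "p \<in> polys_on T" "0 \<in> K" "\<And>x y. x \<in> K \<Longrightarrow> y \<in> K \<Longrightarrow> x + y \<in> K"
    and "\<And>c i. i \<in> T \<Longrightarrow> monom c i \<in> K"
  shows "p \<in> K"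
proof -
  have "(\<Sum>i\<in>A. monom (coeff p i) i) \<in> K" if "finite A" for A
    using that
  proof induction
    case (insert i A)
    have "monom (coeff p i) i \<in> K"
      using assms by (cases "coeff p i = 0") (auto simp: polys_on_def)
    then show ?case using insert assms by simp
  qed (use assms in simp)
  then show ?thesis by (metis finite_atMost poly_as_sum_of_monoms)
qed



context submonoid_nat
begin

text \<open>If \<open>ok i j\<close> fails, then \<open>t\<^sup>i\<^sup>+\<^sup>j\<close> lies deeper in the filtration than the product of the initial
  forms of \<open>t\<^sup>i\<close> and \<open>t\<^sup>j\<close>, which is therefore zero.\<close>

definition tmult :: "'k::field poly \<Rightarrow> 'k poly \<Rightarrow> 'k poly" where
  "tmult p q = (\<Sum>n\<le>degree p + degree q.
     monom (\<Sum>i\<le>n. if ok i (n - i) then coeff p i * coeff q (n - i) else 0) n)"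

lemma coeff_tmult:
  "coeff (tmult p q) n = (\<Sum>i\<le>n. if ok i (n - i) then coeff p i * coeff q (n - i) else 0)"
proof (cases "n \<le> degree p + degree q")
  case True
  then show ?thesis by (simp add: tmult_def coeff_sum)
next
  case False
  have "(if ok i (n - i) then coeff p i * coeff q (n - i) else 0) = 0" if "i \<le> n" for i
  proof -
    have "degree p < i \<or> degree q < n - i" using False by linarith
    then show ?thesis by (auto simp: coeff_eq_0)
  qed
  then have "(\<Sum>i\<le>n. if ok i (n - i) then coeff p i * coeff q (n - i) else 0) = 0"
    by (intro sum.neutral) auto
  then show ?thesis using False by (simp add: tmult_def coeff_sum)
qed

lemma tmult_supp:
  assumes "coeff (tmult p q) n \<noteq> 0"
  obtains i j where "n = i + j" "ok i j" "coeff p i \<noteq> 0" "coeff q j \<noteq> 0"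
proof -
  obtain i where "i \<in> {..n}" "(if ok i (n - i) then coeff p i * coeff q (n - i) else 0) \<noteq> 0"
    using assms unfolding coeff_tmult by (rule sum.not_neutral_contains_not_neutral)
  then show ?thesis using that[of i "n - i"] by (auto split: if_splits)
qed

lemma tmult_closed: "tmult p q \<in> polys_on S"
  unfolding polys_on_def by (auto elim!: tmult_supp simp: ok_def add_in)

lemma tmult_commute: "tmult p q = tmult q p"
proof (rule poly_eqI)
  fix n
  have "(\<Sum>i\<le>n. if ok i (n - i) then coeff p i * coeff q (n - i) else 0)
    = (\<Sum>i\<le>n. if ok i (n - i) then coeff q i * coeff p (n - i) else 0)"
    by (rule sum.reindex_bij_witness[of _ "\<lambda>i. n - i" "\<lambda>i. n - i"])
      (auto simp: mult.commute ok_commute)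
  then show "coeff (tmult p q) n = coeff (tmult q p) n" by (simp add: coeff_tmult)
qed

lemma tmult_add: "tmult (p + q) r = tmult p r + tmult q r"
  by (intro poly_eqI) (auto simp: coeff_tmult sum.distrib[symmetric] algebra_simps intro!: sum.cong)

lemma tmult_assoc: "tmult (tmult p q) r = tmult p (tmult q r)"
proof (rule poly_eqI)
  fix n
  define F where "F i j k = (if ok i j \<and> ok (i + j) k then coeff p i * coeff q j * coeff r k else 0)" for i j k
  have "coeff (tmult (tmult p q) r) n = (\<Sum>j\<le>n. \<Sum>i\<le>j. F i (j - i) (n - j))"
    unfolding coeff_tmult by (intro sum.cong refl) (auto simp: F_def sum_distrib_right intro!: sum.cong)
  also have "\<dots> = (\<Sum>(j, i)\<in>(SIGMA j:{..n}. {..j}). F i (j - i) (n - j))"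
    by (simp add: sum.Sigma)
  also have "\<dots> = (\<Sum>(i, j)\<in>(SIGMA i:{..n}. {..n - i}). F i j (n - i - j))"
    \<comment> \<open>The outer index \<open>j\<close> is the exponent contributed by the first two
      factors together; it is replaced by the exponent of the second factor alone.\<close>
    by (rule sum.reindex_bij_witness[of _ "\<lambda>(i, j). (i + j, i)" "\<lambda>(j, i). (i, j - i)"]) auto
  also have "\<dots> = (\<Sum>i\<le>n. \<Sum>j\<le>n - i. F i j (n - i - j))"
    by (simp add: sum.Sigma)
  also have "\<dots> = coeff (tmult p (tmult q r)) n"
    unfolding coeff_tmult F_def ok_assoc
    by (intro sum.cong refl) (auto simp: sum_distrib_left mult.assoc intro!: sum.cong)
  finally show "coeff (tmult (tmult p q) r) n = coeff (tmult p (tmult q r)) n" .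
qed

lemma tmult_one:
  assumes "p \<in> polys_on S" shows "tmult 1 p = p"
proof (rule poly_eqI)
  fix n
  have "coeff (tmult 1 p) n = (\<Sum>i\<le>n. if i = 0 then (if n \<in> S then coeff p n else 0) else 0)"
    unfolding coeff_tmult by (intro sum.cong refl) auto
  also have "\<dots> = coeff p n" using assms by (auto simp: polys_on_def)
  finally show "coeff (tmult 1 p) n = coeff p n" .
qed

lemma polys_on_one: "1 \<in> polys_on S"
  by (auto simp: polys_on_def zero_in)

definition monomial_ring :: "'k::field poly ring" where
  "monomial_ring = \<lparr>carrier = polys_on S, mult = tmult, one = 1, zero = 0, add = (+)\<rparr>"

lemma monomial_ring_simps [simp]:
  "carrier monomial_ring = polys_on S" "x \<otimes>\<^bsub>monomial_ring\<^esub> y = tmult x y"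
  "\<one>\<^bsub>monomial_ring\<^esub> = 1" "\<zero>\<^bsub>monomial_ring\<^esub> = 0" "x \<oplus>\<^bsub>monomial_ring\<^esub> y = x + y"
  by (simp_all add: monomial_ring_def)

lemma monomial_ring_cring: "cring monomial_ring"
proof (intro cringI abelian_groupI comm_monoidI, simp_all only: monomial_ring_simps)
  show "\<exists>y\<in>polys_on S. y + x = 0" if "x \<in> polys_on S" for x :: "'a poly"
    using that by (intro bexI[of _ "- x"]) simp_all
  show "tmult x y = tmult y x" for x y :: "'a poly" by (rule tmult_commute)
qed (simp_all add: polys_on_add tmult_closed tmult_assoc tmult_one tmult_add polys_on_one add_ac)

end

section \<open>The monomial model as a finite algebra over k[z] with z = t^e\<close>

lemma coeff_pcompose_monom:
  fixes p :: "'a::comm_semiring_1 poly"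
  assumes "e > 0"
  shows "coeff (pcompose p (monom 1 e)) n = (if e dvd n then coeff p (n div e) else 0)"
proof (induction p arbitrary: n)
  case 0
  then show ?case by simp
next
  case (pCons a p)
  have "e dvd n - e \<longleftrightarrow> e dvd n" if "e \<le> n"
    using that by (metis dvd_minus_self not_less)
  moreover have "n div e = Suc ((n - e) div e)" if "e \<le> n"
    using that assms by (simp add: le_div_geq)
  moreover have "e dvd n \<longleftrightarrow> n = 0" if "n < e" using that by (auto dest: dvd_imp_le)
  ultimately show ?case using pCons assms
    by (cases "e \<le> n") (auto simp: pcompose_pCons coeff_monom_mult coeff_pCons split: nat.splits)
qed

text \<open>The assumption \<open>lev_cancel_e\<close> says that the initial form of t^e is a
  nonzerodivisor on monomials: t^(x+e) lies in I^(k+1) only if t^x lies in I^k.\<close>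

locale cm_semigroup = submonoid_nat +
  fixes e
  assumes e_in: "e \<in> S" and e_pos: "0 < e" and e_min: "x \<in> S \<Longrightarrow> x \<noteq> 0 \<Longrightarrow> e \<le> x"
    and cofinite: "finite (UNIV - S)"
    and lev_cancel_e: "x \<in> S \<Longrightarrow> x + e \<in> lev S (Suc k) \<Longrightarrow> x \<in> lev S k"
begin

lemma mult_e_in: "i * e \<in> S"
  by (induction i) (auto simp: zero_in add_in e_in)

lemma lev_mult_le: "x \<in> lev S k \<Longrightarrow> k * e \<le> x"
proof (induction k arbitrary: x)
  case (Suc k)
  then obtain a b where "x = a + b" "a \<in> lev S k" "b \<in> S" "b \<noteq> 0" by auto
  then show ?case using Suc.IH[of a] e_min[of b] by simp
qed simp

lemma ord_mult_le: "x \<in> S \<Longrightarrow> ord S x * e \<le> x"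
  using lev_mult_le[of x "ord S x"] lev_iff[of x "ord S x"] by simp

lemma ord_add_e: "x \<in> S \<Longrightarrow> ord S (x + e) = Suc (ord S x)"
proof (rule antisym)
  assume x: "x \<in> S"
  have "e \<in> lev S 1" using e_in e_pos unfolding One_nat_def lev_1 by simp
  then have "1 \<le> ord S e" using lev_iff[OF e_in] by blast
  then show "Suc (ord S x) \<le> ord S (x + e)" using ord_add[OF x e_in] by linarith
  then obtain k where k: "ord S (x + e) = Suc k" using Suc_le_D by blast
  have "x + e \<in> lev S (Suc k)" using lev_iff[OF add_in[OF x e_in]] k by (simp del: lev.simps)
  then have "x \<in> lev S k" by (rule lev_cancel_e[OF x])
  then show "ord S (x + e) \<le> Suc (ord S x)" using lev_iff[OF x] k by simp
qed

lemma ord_add_mult_e: "x \<in> S \<Longrightarrow> ord S (i * e + x) = i + ord S x"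
proof (induction i)
  case (Suc i)
  then have "ord S (i * e + x + e) = Suc (i + ord S x)"
    using ord_add_e[of "i * e + x"] mult_e_in[of i] add_in by simp
  then show ?case by (simp add: ac_simps)
qed simp

lemma ord_mult_e: "ord S (i * e) = i"
  using ord_add_mult_e[OF zero_in, of i] ord_0 by simp

lemma ok_mult_e: "x \<in> S \<Longrightarrow> ok (i * e) x"
  by (simp add: ok_def mult_e_in ord_add_mult_e ord_mult_e)

text \<open>One more than the last gap. Inserting 0 keeps the maximum defined if there are no
  gaps.\<close>

definition frob :: nat where "frob = Suc (Max (insert 0 (UNIV - S)))"

lemma frob_le_in: "frob \<le> x \<Longrightarrow> x \<in> S"
proof (rule ccontr)
  assume "frob \<le> x" "x \<notin> S"
  then have "x \<le> Max (insert 0 (UNIV - S))" using cofinite by (intro Max_ge) auto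
  then show False using \<open>frob \<le> x\<close> unfolding frob_def by simp
qed

text \<open>Take away copies of \<open>e\<close> until an element of the interval from
  \<open>frob\<close> to \<open>frob + e - 1\<close> remains. It lies in \<open>S\<close>, so each
  removed copy counts towards the order.\<close>

lemma ord_defect_bounded: "x \<in> S \<Longrightarrow> x \<le> ord S x * e + frob + e"
proof (cases "frob \<le> x")
  case True
  define q r where "q = (x - frob) div e" and "r = (x - frob) mod e"
  have x: "x = q * e + (frob + r)" using True by (simp add: q_def r_def)
  have "frob + r \<in> S" by (rule frob_le_in) simp
  then have "q \<le> ord S x" using ord_add_mult_e[of "frob + r" q] x by simp
  then have "q * e \<le> ord S x * e" by simp
  moreover have "r < e" using e_pos by (simp add: r_def)
  ultimately show ?thesis using x by linarith
qed simp

definition phi :: "'k::field poly \<Rightarrow> 'k poly" where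
  "phi p = pcompose p (monom 1 e)"

definition off_e :: "'k::field poly set" where
  "off_e = polys_on {i \<in> S. \<not> e dvd i}"

lemma coeff_phi: "coeff (phi p) n = (if e dvd n then coeff p (n div e) else 0)"
  unfolding phi_def by (rule coeff_pcompose_monom[OF e_pos])

lemma phi_closed: "phi p \<in> polys_on S"
  using mult_e_in by (auto simp: polys_on_def coeff_phi mult.commute split: if_splits)

text \<open>Products with powers of t^e are never truncated. Hence torsion-freeness over k[z] is
  inherited from the domain k[t].\<close>

lemma tmult_phi:
  assumes "q \<in> polys_on S"
  shows "tmult (phi p) q = phi p * q"
proof (rule poly_eqI)
  fix n
  have "(if ok i (n - i) then coeff (phi p) i * coeff q (n - i) else 0) = coeff (phi p) i * coeff q (n - i)" for i
  proof (cases "coeff (phi p) i = 0 \<or> coeff q (n - i) = 0")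
    case False
    then have "e dvd i" "n - i \<in> S" using assms by (auto simp: coeff_phi polys_on_def split: if_splits)
    then have "ok i (n - i)" using ok_mult_e[of "n - i" "i div e"] by simp
    then show ?thesis by simp
  qed auto
  then show "coeff (tmult (phi p) q) n = coeff (phi p * q) n"
    unfolding coeff_tmult coeff_mult by simp
qed

interpretation A: cring "monomial_ring :: 'k::field poly ring"
  by (rule monomial_ring_cring)

lemma monomial_ring_uminus: "p \<in> polys_on S \<Longrightarrow> \<ominus>\<^bsub>monomial_ring\<^esub> p = - p"
  by (rule A.minus_equality) simp_all

lemma monomial_ring_minus:
  "p \<in> polys_on S \<Longrightarrow> q \<in> polys_on S \<Longrightarrow> p \<ominus>\<^bsub>monomial_ring\<^esub> q = p - q"
  by (simp add: a_minus_def monomial_ring_uminus)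

lemma off_e_subset: "off_e \<subseteq> polys_on S"
  unfolding off_e_def by (intro polys_on_mono) auto

text \<open>The order of a multiple m e is m, and in general x is at least e times its order. If the
  orders of i and j add up to m, equality must hold for both. Thus a nonzero product of monomials is
  a power of z only if both factors are, which makes \<open>off_e\<close> an ideal.\<close>

lemma ok_dvd_left:
  assumes "ok i j" "e dvd i + j" shows "e dvd i"
proof -
  obtain m where m: "i + j = m * e" using assms(2) by (metis dvd_def mult.commute)
  then have "ord S i + ord S j = m" using assms(1) ord_mult_e[of m] by (simp add: ok_def)
  then have "ord S i * e + ord S j * e = i + j" using m by (metis add_mult_distrib)
  then have "i = ord S i * e"
    using ord_mult_le[of i] ord_mult_le[of j] assms(1) by (simp add: ok_def)
  then show ?thesis by (metis dvd_triv_right)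
qed

lemma tmult_off_e: "p \<in> off_e \<Longrightarrow> tmult p q \<in> off_e"
  unfolding off_e_def polys_on_def
proof (intro CollectI allI impI)
  fix n assume p: "p \<in> {p. \<forall>i. coeff p i \<noteq> 0 \<longrightarrow> i \<in> {i \<in> S. \<not> e dvd i}}" and "coeff (tmult p q) n \<noteq> 0"
  then obtain i j where ij: "n = i + j" "ok i j" "coeff p i \<noteq> 0" by (metis tmult_supp)
  then show "n \<in> S \<and> \<not> e dvd n" using p ok_dvd_left[of i j] add_in by (auto simp: ok_def)
qed

lemma off_e_ideal: "ideal off_e (monomial_ring :: 'k::field poly ring)"
proof (intro idealI A.ring_axioms A.add.subgroupI, simp_all, goal_cases)
  case 1
  show ?case by (rule off_e_subset)
next
  case 2
  show ?case unfolding off_e_def by (metis polys_on_zero empty_iff)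
next
  case (3 a)
  then have "a \<in> polys_on S" using off_e_subset by blast
  then show ?case using 3 by (simp add: monomial_ring_uminus off_e_def flip: a_inv_def)
next
  case (4 a b)
  then show ?case unfolding off_e_def by (rule polys_on_add)
next
  case (5 a x)
  then show ?case using tmult_off_e tmult_commute by metis
next
  case (6 a x)
  then show ?case using tmult_off_e by blast
qed

text \<open>The defect \<open>i - e * ord i\<close> is bounded, positive off the multiples of \<open>e\<close>, and additive along
  nonzero products of monomials.\<close>

lemma off_e_nilpotent:
  assumes z: "z \<in> off_e" shows "\<exists>k::nat. z [^]\<^bsub>monomial_ring\<^esub> k = \<zero>\<^bsub>monomial_ring\<^esub>"
proof -
  define T where "T k = {i \<in> S. k + ord S i * e \<le> i}" for k
  have z1: "z \<in> polys_on (T 1)"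
  proof -
    have "1 + ord S i * e \<le> i" if "i \<in> S" "\<not> e dvd i" for i
    proof -
      have "ord S i * e \<noteq> i" using that by (metis dvd_triv_right)
      then show ?thesis using ord_mult_le[OF that(1)] by linarith
    qed
    then show ?thesis using z unfolding off_e_def polys_on_def T_def by auto
  qed
  have pow: "z [^]\<^bsub>monomial_ring\<^esub> k \<in> polys_on (T k)" for k :: nat
  proof (induction k)
    case 0
    have "polys_on S \<subseteq> polys_on (T 0)" using ord_mult_le by (intro polys_on_mono) (auto simp: T_def)
    then show ?case using polys_on_one by auto
  next
    case (Suc k)
    have "tmult p z \<in> polys_on (T (Suc k))" if p: "p \<in> polys_on (T k)" for p
      unfolding polys_on_def
    proof (intro CollectI allI impI)
      fix n assume "coeff (tmult p z) n \<noteq> 0"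
      then obtain i j where ij: "n = i + j" "ok i j" "coeff p i \<noteq> 0" "coeff z j \<noteq> 0" by (rule tmult_supp)
      then have "i \<in> T k" "j \<in> T 1" using p z1 by (auto simp: polys_on_def)
      then show "n \<in> T (Suc k)" using ij(1,2) by (auto simp: T_def ok_def add_in add_mult_distrib)
    qed
    then show ?case using Suc by simp
  qed
  have "T (Suc (frob + e)) = {}"
  proof -
    have "\<not> Suc (frob + e) + ord S i * e \<le> i" if "i \<in> S" for i
      using ord_defect_bounded[OF that] by linarith
    then show ?thesis by (auto simp: T_def)
  qed
  then have "z [^]\<^bsub>monomial_ring\<^esub> (Suc (frob + e)) \<in> polys_on {}" using pow by metis
  then have "z [^]\<^bsub>monomial_ring\<^esub> (Suc (frob + e)) = 0" by (auto simp: polys_on_def intro!: poly_eqI)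
  then show ?thesis by (metis monomial_ring_simps(4))
qed

lemma off_e_decomp:
  assumes "z \<in> polys_on S" shows "\<exists>p. z - phi p \<in> off_e"
proof -
  \<comment> \<open>\<open>p\<close> collects the coefficients at the multiples of \<open>e\<close>.
    Summing up to \<open>degree z\<close> is enough since i \<le> i e.\<close>
  define p where "p = (\<Sum>i\<le>degree z. monom (coeff z (i * e)) i)"
  have p: "coeff p i = coeff z (i * e)" for i
  proof (cases "i \<le> degree z")
    case False
    then have "degree z < i * e" using e_pos by (metis less_le_trans linorder_not_le mult_le_mono2 nat_mult_1_right Suc_leI One_nat_def)
    then show ?thesis using False by (simp add: p_def coeff_sum coeff_eq_0)
  qed (simp add: p_def coeff_sum)
  have "coeff (z - phi p) n = (if e dvd n then 0 else coeff z n)" for n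
    by (auto simp: coeff_phi p)
  then have "z - phi p \<in> off_e" using assms by (auto simp: off_e_def polys_on_def)
  then show ?thesis by blast
qed

text \<open>The monomials below \<open>frob + e\<close> generate: for a larger exponent i the number
  i - e is still in \<open>S\<close>, and t^i is z times t^(i-e).\<close>

lemma monomial_ring_finite:
  "\<exists>W. finite W \<and> W \<subseteq> carrier monomial_ring \<and>
     (\<forall>K. poly_submodule monomial_ring (phi :: 'k::field poly \<Rightarrow> _) K \<longrightarrow> W \<subseteq> K \<longrightarrow> carrier monomial_ring \<subseteq> K)"
proof (intro exI conjI allI impI)
  let ?W = "(\<lambda>i. monom (1 :: 'k) i) ` {i \<in> S. i < frob + e}"
  show "finite ?W" by simp
  show "?W \<subseteq> carrier monomial_ring" by (auto intro: polys_on_monom)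
  fix K assume K: "poly_submodule monomial_ring (phi :: 'k poly \<Rightarrow> _) K" and WK: "?W \<subseteq> K"
  have sub: "K \<subseteq> polys_on S" "0 \<in> K" and add: "\<And>x y. x \<in> K \<Longrightarrow> y \<in> K \<Longrightarrow> x + y \<in> K"
    and smult': "\<And>p x. x \<in> K \<Longrightarrow> tmult (phi p) x \<in> K"
    using K unfolding poly_submodule_def by auto
  have smult: "phi p * x \<in> K" if "x \<in> K" for p x
  proof -
    have "x \<in> polys_on S" using sub(1) that by blast
    then show ?thesis using smult'[OF that, of p] tmult_phi[of x p] by simp
  qed
  have m: "monom c i \<in> K" if "i \<in> S" for c :: 'k and i
    using that
  proof (induction i rule: less_induct)
    case (less i)
    show ?case
    proof (cases "i < frob + e")
      case True
      then have "monom 1 i \<in> K" using WK less.prems by blast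
      then have "phi [:c:] * monom 1 i \<in> K" by (rule smult)
      then show ?thesis by (simp add: phi_def smult_monom)
    next
      case False
      then have "i - e \<in> S" by (intro frob_le_in) simp
      then have "monom c (i - e) \<in> K" using less.IH[of "i - e"] False e_pos by simp
      then have "phi [:0, 1:] * monom c (i - e) \<in> K" by (rule smult)
      then show ?thesis using False by (simp add: phi_def pcompose_pCons mult_monom)
    qed
  qed
  show "carrier monomial_ring \<subseteq> K"
    using polys_on_induct[of _ S K] sub(2) add m by auto
qed

theorem monomial_ring_nil_extension:
  "nil_extension monomial_ring (phi :: 'k::field poly \<Rightarrow> _) off_e"
proof (intro nil_extension.intro nil_extension_axioms.intro poly_algebra.intro
    poly_algebra_axioms.intro monomial_ring_cring monomial_ring_finite off_e_ideal off_e_nilpotent)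
  fix z assume "z \<in> carrier (monomial_ring :: 'k poly ring)"
  then have z: "z \<in> polys_on S" by simp
  then show "\<exists>p. z \<ominus>\<^bsub>monomial_ring\<^esub> phi p \<in> off_e"
    using off_e_decomp[OF z] monomial_ring_minus[OF z phi_closed] by metis
  fix p :: "'k poly" assume p: "p \<noteq> 0" "phi p \<otimes>\<^bsub>monomial_ring\<^esub> z = \<zero>\<^bsub>monomial_ring\<^esub>"
  then have "phi p * z = 0" using z by (simp add: tmult_phi)
  moreover have "phi p \<noteq> 0"
  proof
    assume "phi p = 0"
    then have "coeff p i = 0" for i
      using coeff_phi[of p "i * e"] e_pos by simp
    then show False using p(1) by (simp add: poly_eq_iff)
  qed
  ultimately show "z = \<zero>\<^bsub>monomial_ring\<^esub>" by simp
next
  fix p q :: "'k poly"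
  show "phi (p * q) = phi p \<otimes>\<^bsub>monomial_ring\<^esub> phi q"
    by (simp add: tmult_phi phi_closed) (simp add: phi_def pcompose_mult)
qed (simp_all add: phi_closed, simp_all add: phi_def pcompose_add pcompose_1)

end

section \<open>The semigroup ring, the powers of its monomial ideal, and the isomorphism with the
  graded ring\<close>

declare lev.simps(2) [simp del]

context submonoid_nat
begin

lemma min_gens_iff:
  "h \<in> min_gens S \<longleftrightarrow> h \<in> S \<and> h \<noteq> 0 \<and> (\<forall>y\<in>S. \<forall>z\<in>S. y \<noteq> 0 \<longrightarrow> z \<noteq> 0 \<longrightarrow> h \<noteq> y + z)"
  using min_gens_eq[of S] zero_in add_in by auto

lemma min_gens_split:
  assumes "x \<in> S" "x \<noteq> 0"
  obtains h y where "x = h + y" "h \<in> min_gens S" "y \<in> S"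
proof -
  have "\<exists>h y. x = h + y \<and> h \<in> min_gens S \<and> y \<in> S"
    using assms
  proof (induction x rule: less_induct)
    case (less x)
    show ?case
    proof (cases "x \<in> min_gens S")
      case True
      then show ?thesis using zero_in by (intro exI[of _ x] exI[of _ 0]) auto
    next
      case False
      then obtain y z where yz: "y \<in> S" "z \<in> S" "y \<noteq> 0" "z \<noteq> 0" "x = y + z"
        using less.prems unfolding min_gens_iff by blast
      then obtain h y' where "y = h + y'" "h \<in> min_gens S" "y' \<in> S" using less.IH[of y] by auto
      then show ?thesis using yz add_in by (intro exI[of _ h] exI[of _ "y' + z"]) auto
    qed
  qed
  then show ?thesis using that by blast
qed

lemma monom_in_subalgebra: "x \<in> S \<Longrightarrow> monom (1 :: 'k::field) x \<in> subalgebra_gen (gen_monomials S)"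
proof (induction x rule: less_induct)
  case (less x)
  show ?case
  proof (cases "x = 0")
    case True
    then show ?thesis using subalgebra_gen.const[of 1] by (simp add: monom_0)
  next
    case False
    then obtain h y where hy: "x = h + y" "h \<in> min_gens S" "y \<in> S" using less.prems min_gens_split by blast
    then have "h \<noteq> 0" by (simp add: min_gens_iff)
    then have "monom (1 :: 'k) y \<in> subalgebra_gen (gen_monomials S)" using less.IH hy by simp
    moreover have "monom (1 :: 'k) h \<in> subalgebra_gen (gen_monomials S)"
      using hy by (intro subalgebra_gen.incl) (auto simp: gen_monomials_def)
    ultimately have "monom (1 :: 'k) h * monom 1 y \<in> subalgebra_gen (gen_monomials S)"
      by (intro subalgebra_gen.times)
    then show ?thesis by (simp add: mult_monom hy(1))
  qed
qed

lemma subalgebra_gen_eq: "subalgebra_gen (gen_monomials S) = (polys_on S :: 'k::field poly set)"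
proof
  show "subalgebra_gen (gen_monomials S) \<subseteq> (polys_on S :: 'k poly set)"
  proof
    fix p :: "'k poly" assume "p \<in> subalgebra_gen (gen_monomials S)"
    then show "p \<in> polys_on S"
    proof induction
      case (const a)
      then show ?case using polys_on_monom[OF zero_in, of a] by (simp add: monom_0)
    next
      case (incl p)
      then show ?case by (auto simp: gen_monomials_def min_gens_iff intro: polys_on_monom)
    next
      case (plus p q)
      then show ?case by (intro polys_on_add)
    next
      case (times p q)
      then show ?case using polys_on_mult add_in by blast
    qed
  qed
  show "(polys_on S :: 'k poly set) \<subseteq> subalgebra_gen (gen_monomials S)"
  proof
    fix p :: "'k poly" assume "p \<in> polys_on S"
    then show "p \<in> subalgebra_gen (gen_monomials S)"
    proof (rule polys_on_induct)
      show "0 \<in> subalgebra_gen (gen_monomials S :: 'k poly set)"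
        using subalgebra_gen.const[of 0] by simp
      fix c :: 'k and i assume "i \<in> S"
      then have "[:c:] * monom 1 i \<in> subalgebra_gen (gen_monomials S)"
        by (intro subalgebra_gen.times subalgebra_gen.const monom_in_subalgebra)
      then show "monom c i \<in> subalgebra_gen (gen_monomials S)" by (simp add: smult_monom)
    qed (rule subalgebra_gen.plus)
  qed
qed

abbreviation R :: "'k::field poly ring" where "R \<equiv> semigroup_ring S"

abbreviation I :: "'k::field poly set" where "I \<equiv> Idl\<^bsub>R\<^esub> (gen_monomials S)"

lemma semigroup_ring_simps [simp]:
  "carrier R = polys_on S" "x \<otimes>\<^bsub>R\<^esub> y = x * y"
  "\<one>\<^bsub>R\<^esub> = 1" "\<zero>\<^bsub>R\<^esub> = 0" "x \<oplus>\<^bsub>R\<^esub> y = x + y"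
  by (simp_all add: semigroup_ring_def subalgebra_gen_eq)

lemma semigroup_ring_cring: "cring (R :: 'k::field poly ring)"
proof (intro cringI abelian_groupI comm_monoidI, simp_all only: semigroup_ring_simps)
  show "\<exists>y\<in>polys_on S. y + x = 0" if "x \<in> polys_on S" for x :: "'k poly"
    using that by (intro bexI[of _ "- x"]) simp_all
  show "x * y \<in> polys_on S" if "x \<in> polys_on S" "y \<in> polys_on S" for x y :: "'k poly"
    using that add_in polys_on_mult by blast
qed (simp_all add: polys_on_add polys_on_one algebra_simps)

interpretation R: cring "R :: 'k::field poly ring"
  by (rule semigroup_ring_cring)

lemma semigroup_ring_uminus: "p \<in> polys_on S \<Longrightarrow> \<ominus>\<^bsub>R\<^esub> p = - p"
  by (rule R.minus_equality) simp_all

lemma lev_polys_subset: "polys_on (lev S k) \<subseteq> polys_on S"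
  using lev_subset by (intro polys_on_mono) blast

lemma lev_polys_mult:
  "p \<in> polys_on (lev S i) \<Longrightarrow> q \<in> polys_on (lev S j) \<Longrightarrow> p * q \<in> polys_on (lev S (i + j))"
  using polys_on_mult lev_add by blast

lemma lev_polys_ideal: "ideal (polys_on (lev S k)) (R :: 'k::field poly ring)"
proof (intro idealI R.ring_axioms R.add.subgroupI, simp_all only: semigroup_ring_simps, goal_cases)
  case 1
  show ?case by (rule lev_polys_subset)
next
  case 2
  show ?case using polys_on_zero by blast
next
  case (3 a)
  then have "a \<in> polys_on S" using lev_polys_subset by blast
  then show ?case using 3 by (simp add: semigroup_ring_uminus flip: a_inv_def)
next
  case (4 a b)
  then show ?case by (simp add: polys_on_add)
next
  case (5 a x)
  then show ?case using lev_polys_mult[of x 0 a k] by simp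
next
  case (6 a x)
  then show ?case using lev_polys_mult[of a k x 0] by simp
qed



lemma irrelevant_ideal_eq: "(I :: 'k::field poly set) = polys_on (lev S (Suc 0))"
proof
  have gens: "gen_monomials S \<subseteq> (polys_on (lev S (Suc 0)) :: 'k poly set)"
    unfolding lev_1 by (auto simp: gen_monomials_def min_gens_iff intro: polys_on_monom)
  then show "I \<subseteq> (polys_on (lev S (Suc 0)) :: 'k poly set)"
    by (rule R.genideal_minimal[OF lev_polys_ideal])
  have "gen_monomials S \<subseteq> carrier (R :: 'k poly ring)"
    using gens lev_polys_subset by auto
  then have sub: "gen_monomials S \<subseteq> (I :: 'k poly set)" and "ideal I (R :: 'k poly ring)"
    by (rule R.genideal_self, rule R.genideal_ideal)
  then interpret I: ideal I "R :: 'k poly ring" by simp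
  show "(polys_on (lev S (Suc 0)) :: 'k poly set) \<subseteq> I"
  proof
    fix p :: "'k poly" assume "p \<in> polys_on (lev S (Suc 0))"
    then show "p \<in> I"
    proof (rule polys_on_induct)
      show "0 \<in> (I :: 'k poly set)" using I.zero_closed by simp
      show "x + y \<in> I" if "x \<in> I" "y \<in> I" for x y :: "'k poly" using I.a_closed[OF that] by simp
      fix c :: 'k and i assume "i \<in> lev S (Suc 0)"
      then have "i \<in> S" "i \<noteq> 0" unfolding lev_1 by auto
      then obtain h y where hy: "i = h + y" "h \<in> min_gens S" "y \<in> S" using min_gens_split by blast
      have "monom c y \<in> carrier R" using hy by (simp add: polys_on_monom)
      moreover have "monom 1 h \<in> (I :: 'k poly set)" using sub hy by (auto simp: gen_monomials_def)
      ultimately have "monom c y \<otimes>\<^bsub>R\<^esub> monom 1 h \<in> I" using I.I_l_closed by blast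
      then show "monom c i \<in> I" by (simp add: mult_monom hy(1) add.commute)
    qed
  qed
qed

text \<open>The ideal is spanned by monomials, and so are its powers. From here on the filtration of
  the ring is a matter of exponents.\<close>

lemma ideal_power_eq: "ideal_power R I k = (polys_on (lev S k) :: 'k::field poly set)"
proof (induction k)
  case (Suc k)
  have "ideal_prod R (polys_on (lev S k)) (polys_on (lev S (Suc 0))) = (polys_on (lev S (Suc k)) :: 'k poly set)"
  proof
    show "ideal_prod R (polys_on (lev S k)) (polys_on (lev S (Suc 0))) \<subseteq> (polys_on (lev S (Suc k)) :: 'k poly set)"
    proof
      fix p :: "'k poly" assume "p \<in> ideal_prod R (polys_on (lev S k)) (polys_on (lev S (Suc 0)))"
      then show "p \<in> polys_on (lev S (Suc k))"
      proof induction
        case (prod i j)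
        then show ?case using lev_polys_mult[of i k j "Suc 0"] by simp
      next
        case (sum s1 s2)
        then show ?case by (simp add: polys_on_add)
      qed
    qed
    show "(polys_on (lev S (Suc k)) :: 'k poly set) \<subseteq> ideal_prod R (polys_on (lev S k)) (polys_on (lev S (Suc 0)))"
      (is "_ \<subseteq> ?J")
    proof
      fix p :: "'k poly" assume "p \<in> polys_on (lev S (Suc k))"
      then show "p \<in> ?J"
      proof (rule polys_on_induct)
        \<comment> \<open>The inductive set \<open>ideal_prod\<close> has rules for products and
          sums only, so 0 enters as a product.\<close>
        have "0 \<otimes>\<^bsub>R\<^esub> 0 \<in> ?J" by (intro ideal_prod.prod polys_on_zero)
        then show "0 \<in> ?J" by simp
        show "x + y \<in> ?J" if "x \<in> ?J" "y \<in> ?J" for x y using ideal_prod.sum[OF that] by simp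
        fix c :: 'k and i assume "i \<in> lev S (Suc k)"
        then obtain x y where xy: "i = x + y" "x \<in> lev S k" "y \<in> S" "y \<noteq> 0"
          unfolding lev.simps(2) by blast
        then have "y \<in> lev S (Suc 0)" unfolding lev_1 by simp
        then have "monom c x \<otimes>\<^bsub>R\<^esub> monom 1 y \<in> ?J" using xy by (intro ideal_prod.prod polys_on_monom)
        then show "monom c i \<in> ?J" by (simp add: mult_monom xy(1))
      qed
    qed
  qed
  then show ?case using Suc by (simp add: irrelevant_ideal_eq)
qed simp

text \<open>For \<open>a \<in> I\<^sup>k\<close>, the set \<open>lcoset k a\<close> is the class of \<open>a\<close> in \<open>I\<^sup>k / I\<^sup>k\<^sup>+\<^sup>1\<close>.\<close>

definition lcoset :: "nat \<Rightarrow> 'k::field poly \<Rightarrow> 'k poly set" where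
  "lcoset k a = {x. x - a \<in> polys_on (lev S (Suc k))}"

lemma a_r_coset_eq: "polys_on (lev S (Suc k)) +>\<^bsub>R\<^esub> a = lcoset k a"
proof -
  have "polys_on (lev S (Suc k)) +>\<^bsub>R\<^esub> a = (\<Union>h\<in>polys_on (lev S (Suc k)). {h + a})"
    by (simp add: a_r_coset_def r_coset_def)
  also have "\<dots> = lcoset k a"
  proof -
    have "x \<in> (\<Union>h\<in>polys_on (lev S (Suc k)). {h + a})" if "x - a \<in> polys_on (lev S (Suc k))" for x
      using that by (intro UN_I[of "x - a"]) simp_all
    then show ?thesis unfolding lcoset_def by auto
  qed
  finally show ?thesis .
qed

lemma lcoset_0: "lcoset k 0 = polys_on (lev S (Suc k))"
  by (simp add: lcoset_def)

lemma lcoset_eq_iff: "lcoset k a = lcoset k b \<longleftrightarrow> a - b \<in> polys_on (lev S (Suc k))"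
proof
  assume "lcoset k a = lcoset k b"
  moreover have "a \<in> lcoset k a" by (simp add: lcoset_def)
  ultimately show "a - b \<in> polys_on (lev S (Suc k))" by (simp add: lcoset_def)
next
  assume ab: "a - b \<in> polys_on (lev S (Suc k))"
  have "x - a \<in> polys_on (lev S (Suc k)) \<longleftrightarrow> x - b \<in> polys_on (lev S (Suc k))" for x
    using polys_on_add[OF _ ab, of "x - a"] polys_on_diff[OF _ ab, of "x - b"] by auto
  then show "lcoset k a = lcoset k b" unfolding lcoset_def by blast
qed

lemma lcoset_add: "lcoset k a <+>\<^bsub>R\<^esub> lcoset k b = lcoset k (a + b)"
proof -
  have "lcoset k a <+>\<^bsub>R\<^esub> lcoset k b = {x + y | x y. x \<in> lcoset k a \<and> y \<in> lcoset k b}"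
    by (auto simp: set_add_def set_mult_def)
  also have "\<dots> = lcoset k (a + b)"
  proof (intro equalityI subsetI)
    fix z assume "z \<in> {x + y | x y. x \<in> lcoset k a \<and> y \<in> lcoset k b}"
    then obtain x y where "z = x + y" "x \<in> lcoset k a" "y \<in> lcoset k b" by blast
    then show "z \<in> lcoset k (a + b)"
      using polys_on_add[of "x - a" _ "y - b"] by (simp add: lcoset_def algebra_simps)
  next
    fix z assume "z \<in> lcoset k (a + b)"
    then have "z = (z - b) + b" "z - b \<in> lcoset k a" "b \<in> lcoset k b"
      by (simp_all add: lcoset_def algebra_simps)
    then show "z \<in> {x + y | x y. x \<in> lcoset k a \<and> y \<in> lcoset k b}" by blast
  qed
  finally show ?thesis .
qed

text \<open>The factors are cosets of I^(i+1) and I^(j+1), while the product is taken modulo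
  I^(i+j+1). It is well defined since a b - p q = (a - p) b + p (b - q).\<close>

lemma lcoset_mult:
  assumes p: "p \<in> polys_on (lev S i)" and q: "q \<in> polys_on (lev S j)"
  shows "rcoset_mult R (polys_on (lev S (Suc (i + j)))) (lcoset i p) (lcoset j q) = lcoset (i + j) (p * q)"
proof -
  have "lcoset (i + j) (a * b) = lcoset (i + j) (p * q)" if "a \<in> lcoset i p" "b \<in> lcoset j q" for a b
  proof -
    have "a - p \<in> polys_on (lev S (Suc i))" "b - q \<in> polys_on (lev S (Suc j))"
      using that by (simp_all add: lcoset_def)
    moreover have "polys_on (lev S (Suc j)) \<subseteq> polys_on (lev S j)"
      using lev_Suc_subset by (intro polys_on_mono) blast
    ultimately have "b \<in> polys_on (lev S j)" using polys_on_add[OF q, of "b - q"] by auto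
    then have "(a - p) * b \<in> polys_on (lev S (Suc (i + j)))" "p * (b - q) \<in> polys_on (lev S (Suc (i + j)))"
      using lev_polys_mult[of "a - p" "Suc i" b j] lev_polys_mult[of p i "b - q" "Suc j"] p
        \<open>a - p \<in> _\<close> \<open>b - q \<in> _\<close> by (simp_all)
    then have "(a - p) * b + p * (b - q) \<in> polys_on (lev S (Suc (i + j)))" by (rule polys_on_add)
    then show ?thesis unfolding lcoset_eq_iff by (simp add: algebra_simps)
  qed
  moreover have "p \<in> lcoset i p" "q \<in> lcoset j q" by (simp_all add: lcoset_def)
  ultimately have "(\<Union>a\<in>lcoset i p. \<Union>b\<in>lcoset j q. lcoset (i + j) (a * b)) = lcoset (i + j) (p * q)"
    by blast
  then show ?thesis unfolding rcoset_mult_def a_r_coset_eq by simp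
qed

text \<open>The projection to the quotient is a ring homomorphism, so it commutes with finite sums.
  This evaluates the \<open>finsum\<close> in the product of \<open>assoc_graded\<close>.\<close>

lemma finsum_lcoset:
  fixes c :: "'b \<Rightarrow> 'k::field poly"
  assumes "finite X" "\<And>i. i \<in> X \<Longrightarrow> c i \<in> polys_on S" "\<And>i. i \<in> X \<Longrightarrow> g i = lcoset k (c i)"
  shows "finsum (R Quot polys_on (lev S (Suc k))) g X = lcoset k (\<Sum>i\<in>X. c i)"
proof -
  let ?P = "polys_on (lev S (Suc k)) :: 'k poly set"
  interpret P: ideal ?P "R :: 'k poly ring" by (rule lev_polys_ideal)
  interpret h: ring_hom_cring R "R Quot ?P" "(+>\<^bsub>R\<^esub>) ?P"
    by (rule P.rcos_ring_hom_cring[OF R.is_cring])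
  have sum: "finsum R c X = (\<Sum>i\<in>X. c i)" using assms(1,2)
    by induction (simp_all add: Pi_def)
  have "finsum (R Quot ?P) g X = finsum (R Quot ?P) (\<lambda>i. lcoset k (c i)) X"
    using h.hom_closed assms(2,3) by (intro h.S.finsum_cong') (auto simp: a_r_coset_eq)
  also have "\<dots> = lcoset k (\<Sum>i\<in>X. c i)"
    using h.hom_finsum[of c X] assms(2) sum by (simp add: a_r_coset_eq Pi_def o_def)
  finally show ?thesis .
qed

text \<open>Outside \<open>S\<close> the value of \<open>ord\<close> is the maximum of an empty set.
  This is harmless, since the polynomials to which the transfer applies are supported on
  \<open>S\<close>.\<close>

definition hpart :: "nat \<Rightarrow> 'k::field poly \<Rightarrow> 'k poly" where
  "hpart k p = (\<Sum>i\<le>degree p. if ord S i = k then monom (coeff p i) i else 0)"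

lemma coeff_hpart: "coeff (hpart k p) i = (if ord S i = k then coeff p i else 0)"
proof -
  have "coeff (hpart k p) i = (\<Sum>j\<le>degree p. if j = i then (if ord S i = k then coeff p i else 0) else 0)"
    unfolding hpart_def coeff_sum by (intro sum.cong refl) auto
  then show ?thesis by (auto simp: coeff_eq_0)
qed

lemma hpart_in_lev: "p \<in> polys_on S \<Longrightarrow> hpart k p \<in> polys_on (lev S k)"
  by (auto simp: polys_on_def coeff_hpart lev_iff split: if_splits)

lemma hpart_add: "hpart k (p + q) = hpart k p + hpart k q"
  by (rule poly_eqI) (simp add: coeff_hpart)

lemma lcoset_hpart:
  assumes "p \<in> polys_on (lev S k)" shows "lcoset k (hpart k p) = lcoset k p"
proof -
  have "i \<in> lev S (Suc k)" if "coeff (hpart k p - p) i \<noteq> 0" for i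
  proof -
    have i: "ord S i \<noteq> k" "coeff p i \<noteq> 0" using that by (auto simp: coeff_hpart split: if_splits)
    then have "i \<in> lev S k" using assms by (auto simp: polys_on_def)
    then have "i \<in> S" "k \<le> ord S i" using lev_subset lev_iff by blast+
    then show ?thesis using i lev_iff[of i "Suc k"] by simp
  qed
  then show ?thesis unfolding lcoset_eq_iff polys_on_def by blast
qed

lemma finite_hpart: "finite {k. hpart k p \<noteq> 0}"
proof (rule finite_subset)
  show "{k. hpart k p \<noteq> 0} \<subseteq> ord S ` {..degree p}"
  proof
    fix k assume "k \<in> {k. hpart k p \<noteq> 0}"
    then obtain i where "coeff (hpart k p) i \<noteq> 0" by (auto simp: poly_eq_iff)
    then have "ord S i = k" "coeff p i \<noteq> 0" by (auto simp: coeff_hpart split: if_splits)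
    then show "k \<in> ord S ` {..degree p}" using le_degree by blast
  qed
qed simp

abbreviation G :: "(nat \<Rightarrow> 'k::field poly set) ring" where "G \<equiv> graded_semigroup_ring S"

lemma graded_simps:
  "carrier G = {f. (\<forall>k. \<exists>a\<in>polys_on (lev S k). f k = lcoset k a) \<and> finite {k. f k \<noteq> lcoset k 0}}"
  "f \<otimes>\<^bsub>G\<^esub> g = (\<lambda>k. \<Oplus>\<^bsub>R Quot polys_on (lev S (Suc k))\<^esub>i\<in>{..k}.
     rcoset_mult R (polys_on (lev S (Suc k))) (f i) (g (k - i)))"
  "\<one>\<^bsub>G\<^esub> = (\<lambda>k. if k = 0 then lcoset 0 1 else lcoset k 0)"
  "\<zero>\<^bsub>G\<^esub> = (\<lambda>k. lcoset k 0)"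
  "f \<oplus>\<^bsub>G\<^esub> g = (\<lambda>k. f k <+>\<^bsub>R\<^esub> g k)"
  unfolding graded_semigroup_ring_def assoc_graded_def ideal_power_eq a_r_coset_eq lcoset_0
    One_nat_def
  by (simp_all add: a_r_coset_eq cong: if_cong)

text \<open>Not the initial form of \<open>p\<close> as an element of the filtered ring, which would
  not be additive: each monomial is sent to its own initial form, and the map is extended
  linearly.\<close>

definition initial :: "'k::field poly \<Rightarrow> nat \<Rightarrow> 'k poly set" where
  "initial p = (\<lambda>k. lcoset k (hpart k p))"

lemma initial_closed:
  assumes "p \<in> polys_on S" shows "initial p \<in> carrier G"
proof -
  have "finite {k. lcoset k (hpart k p) \<noteq> lcoset k 0}"
    by (rule finite_subset[OF _ finite_hpart[of p]]) auto
  then show ?thesis unfolding graded_simps initial_def using hpart_in_lev[OF assms] by blast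
qed

lemma initial_inj:
  assumes "p \<in> polys_on S" "q \<in> polys_on S" "initial p = initial q" shows "p = q"
proof (rule poly_eqI)
  fix i
  show "coeff p i = coeff q i"
  proof (cases "i \<in> S")
    case True
    have "lcoset (ord S i) (hpart (ord S i) p) = lcoset (ord S i) (hpart (ord S i) q)"
      using assms(3) unfolding initial_def by metis
    then have *: "hpart (ord S i) p - hpart (ord S i) q \<in> polys_on (lev S (Suc (ord S i)))"
      unfolding lcoset_eq_iff .
    have "i \<notin> lev S (Suc (ord S i))" using lev_iff[OF True, of "Suc (ord S i)"] by simp
    then have "coeff (hpart (ord S i) p - hpart (ord S i) q) i = 0"
      using * unfolding polys_on_def by blast
    then show ?thesis by (simp add: coeff_hpart)
  next
    case False
    then have "coeff p i = 0" "coeff q i = 0" using assms by (auto simp: polys_on_def)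
    then show ?thesis by simp
  qed
qed

lemma initial_surj:
  assumes "f \<in> carrier (G :: (nat \<Rightarrow> 'k::field poly set) ring)"
  shows "\<exists>p\<in>polys_on S. initial p = f"
proof -
  have ex: "\<forall>k. \<exists>a. a \<in> polys_on (lev S k) \<and> f k = lcoset k a"
    and fin: "finite {k. f k \<noteq> lcoset k 0}"
    using assms unfolding graded_simps by blast+
  obtain a where a: "\<And>k. a k \<in> polys_on (lev S k)" "\<And>k. f k = lcoset k (a k)"
    using choice[OF ex] by blast
  define X where "X = {k. f k \<noteq> lcoset k 0}"
  \<comment> \<open>Only the terms of order exactly k of the representative \<open>a k\<close> are
    kept. The summands then have disjoint supports, and the component of \<open>p\<close> in degree
    k is \<open>hpart k (a k)\<close>.\<close>
  define p where "p = (\<Sum>k\<in>X. hpart k (a k))"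
  have aS: "a k \<in> polys_on S" for k using a(1) lev_polys_subset by blast
  have coeff_p: "coeff p i = (if ord S i \<in> X then coeff (a (ord S i)) i else 0)" for i
  proof -
    have "coeff p i = (\<Sum>k\<in>X. if ord S i = k then coeff (a (ord S i)) i else 0)"
      unfolding p_def coeff_sum by (intro sum.cong refl) (auto simp: coeff_hpart)
    then show ?thesis using fin by (simp add: X_def)
  qed
  have "p \<in> polys_on S" using aS by (auto simp: polys_on_def coeff_p)
  moreover have "lcoset k (hpart k p) = f k" for k
  proof (cases "k \<in> X")
    case True
    then have "hpart k p = hpart k (a k)" by (intro poly_eqI) (simp add: coeff_hpart coeff_p)
    then show ?thesis using lcoset_hpart[OF a(1)] a(2) by simp
  next
    case False
    then have "hpart k p = 0" by (intro poly_eqI) (simp add: coeff_hpart coeff_p)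
    then show ?thesis using False by (simp add: X_def)
  qed
  ultimately show ?thesis unfolding initial_def by blast
qed

lemma initial_add: "initial (p + q) = initial p \<oplus>\<^bsub>G\<^esub> initial q"
  by (simp add: initial_def graded_simps lcoset_add hpart_add)

lemma initial_zero: "initial (0 :: 'k::field poly) = \<zero>\<^bsub>G\<^esub>"
proof -
  have "hpart k (0 :: 'k poly) = 0" for k by (rule poly_eqI) (simp add: coeff_hpart)
  then show ?thesis by (simp add: initial_def graded_simps)
qed

lemma initial_one: "initial (1 :: 'k::field poly) = \<one>\<^bsub>G\<^esub>"
proof -
  have "hpart k (1 :: 'k poly) = (if k = 0 then 1 else 0)" for k
    by (rule poly_eqI) (use ord_0 in \<open>auto simp: coeff_hpart intro: gr0I\<close>)
  then show ?thesis unfolding initial_def graded_simps by (intro ext) simp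
qed

text \<open>In degree k, the product of the families is represented by the sum of all products of
  two terms whose orders add up to k. The truncated product keeps those among them whose exponent
  has order k. The exponents of all others have larger order, so they vanish modulo I^(k+1).\<close>

lemma initial_tmult:
  assumes "p \<in> polys_on S" "q \<in> polys_on S"
  shows "initial (tmult p q) = initial p \<otimes>\<^bsub>G\<^esub> initial q"
proof
  fix k
  define c where "c i = hpart i p * hpart (k - i) q" for i
  have "rcoset_mult R (polys_on (lev S (Suc k))) (lcoset i (hpart i p)) (lcoset (k - i) (hpart (k - i) q))
      = lcoset k (c i)" if "i \<le> k" for i
    using lcoset_mult[OF hpart_in_lev[OF assms(1), of i] hpart_in_lev[OF assms(2), of "k - i"]] that
    by (simp add: c_def)
  moreover have "c i \<in> polys_on S" for i
    unfolding c_def using assms hpart_in_lev lev_polys_subset add_in polys_on_mult by (metis subsetD)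
  ultimately have "(initial p \<otimes>\<^bsub>G\<^esub> initial q) k = lcoset k (\<Sum>i\<le>k. c i)"
    unfolding graded_simps initial_def by (intro finsum_lcoset) simp_all
  moreover have "n \<in> lev S (Suc k)" if n: "coeff (hpart k (tmult p q) - (\<Sum>i\<le>k. c i)) n \<noteq> 0" for n
  proof -
    have "coeff (c i) n = (\<Sum>m\<le>n. if ord S m = i \<and> ord S (n - m) = k - i then coeff p m * coeff q (n - m) else 0)" for i
      unfolding c_def coeff_mult by (intro sum.cong refl) (auto simp: coeff_hpart)
    then have "coeff (\<Sum>i\<le>k. c i) n
      = (\<Sum>m\<le>n. \<Sum>i\<le>k. if ord S m = i \<and> ord S (n - m) = k - i then coeff p m * coeff q (n - m) else 0)"
      unfolding coeff_sum by (simp add: sum.swap[of _ "{..k}"])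
    also have "\<dots> = (\<Sum>m\<le>n. if ord S m + ord S (n - m) = k then coeff p m * coeff q (n - m) else 0)"
    proof (intro sum.cong refl)
      fix m
      have "(\<Sum>i\<le>k. if ord S m = i \<and> ord S (n - m) = k - i then coeff p m * coeff q (n - m) else 0)
        = (\<Sum>i\<le>k. if ord S m = i then (if ord S (n - m) = k - ord S m then coeff p m * coeff q (n - m) else 0) else 0)"
        by (intro sum.cong refl) auto
      then show "(\<Sum>i\<le>k. if ord S m = i \<and> ord S (n - m) = k - i then coeff p m * coeff q (n - m) else 0)
        = (if ord S m + ord S (n - m) = k then coeff p m * coeff q (n - m) else 0)" by auto
    qed
    finally have "coeff (hpart k (tmult p q) - (\<Sum>i\<le>k. c i)) n
      = (\<Sum>m\<le>n. (if ord S n = k \<and> ok m (n - m) then coeff p m * coeff q (n - m) else 0)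
          - (if ord S m + ord S (n - m) = k then coeff p m * coeff q (n - m) else 0))"
      by (auto simp: coeff_hpart coeff_tmult sum_subtractf sum_negf intro!: sum.cong)
    with n obtain m where m: "m \<le> n"
      "(if ord S n = k \<and> ok m (n - m) then coeff p m * coeff q (n - m) else 0)
          - (if ord S m + ord S (n - m) = k then coeff p m * coeff q (n - m) else 0) \<noteq> 0"
      by (metis (no_types, lifting) atMost_iff sum.not_neutral_contains_not_neutral)
    then have "coeff p m \<noteq> 0" "coeff q (n - m) \<noteq> 0" by (auto split: if_splits)
    then have S: "m \<in> S" "n - m \<in> S" using assms by (auto simp: polys_on_def)
    then have nS: "n \<in> S" using add_in[OF S] m(1) by simp
    have le: "ord S m + ord S (n - m) \<le> ord S n" using ord_add[OF S] m(1) by simp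
    have "ord S m + ord S (n - m) = k \<and> ord S n \<noteq> k"
      using m S by (auto simp: ok_def split: if_splits)
    then show ?thesis using le lev_iff[OF nS, of "Suc k"] by simp
  qed
  then have "lcoset k (hpart k (tmult p q)) = lcoset k (\<Sum>i\<le>k. c i)"
    unfolding lcoset_eq_iff polys_on_def by blast
  ultimately show "initial (tmult p q) k = (initial p \<otimes>\<^bsub>G\<^esub> initial q) k"
    by (simp add: initial_def)
qed

theorem initial_iso: "initial \<in> ring_iso monomial_ring (G :: (nat \<Rightarrow> 'k::field poly set) ring)"
proof (rule ring_iso_memI)
  show "bij_betw initial (carrier monomial_ring) (carrier (G :: (nat \<Rightarrow> 'k poly set) ring))"
    unfolding bij_betw_def inj_on_def
    using initial_closed initial_inj initial_surj by fastforce
qed (simp_all add: initial_closed initial_tmult initial_add initial_one)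

end

theorem (in cm_semigroup) cohen_macaulay_graded_semigroup_ring:
  "cohen_macaulay (graded_semigroup_ring S :: (nat \<Rightarrow> 'k::field poly set) ring)"
proof -
  interpret A: nil_extension monomial_ring "phi :: 'k poly \<Rightarrow> 'k poly" off_e
    by (rule monomial_ring_nil_extension)
  interpret G: nil_extension "graded_semigroup_ring S" "initial \<circ> (phi :: 'k poly \<Rightarrow> 'k poly)" "initial ` off_e"
    by (rule A.transport[OF initial_iso]) (simp add: initial_zero)
  show ?thesis by (rule G.cohen_macaulay)
qed

section \<open>Factorizations of different lengths\<close>

text \<open>Factorizations are multisets, so that exchanging members is multiset arithmetic. They
  are taken over the given generators \<open>N\<close>, which may properly contain the minimal
  ones.\<close>

definition has_fact :: "nat set \<Rightarrow> nat \<Rightarrow> nat \<Rightarrow> bool" where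
  "has_fact N x l \<longleftrightarrow> (\<exists>A. set_mset A \<subseteq> N \<and> sum_mset A = x \<and> size A = l)"

lemma has_fact_add: "has_fact N x l \<Longrightarrow> has_fact N y l' \<Longrightarrow> has_fact N (x + y) (l + l')"
proof -
  assume "has_fact N x l" "has_fact N y l'"
  then obtain A B where "set_mset A \<subseteq> N" "sum_mset A = x" "size A = l"
    "set_mset B \<subseteq> N" "sum_mset B = y" "size B = l'" unfolding has_fact_def by blast
  then show ?thesis unfolding has_fact_def by (intro exI[of _ "A + B"]) auto
qed

lemma has_fact_single: "a \<in> N \<Longrightarrow> has_fact N a 1"
  unfolding has_fact_def by (intro exI[of _ "{#a#}"]) simp

lemma has_fact_zero: "has_fact N 0 0"
  unfolding has_fact_def by (intro exI[of _ "{#}"]) simp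

lemma has_fact_0_iff: "has_fact N x 0 \<longleftrightarrow> x = 0"
  by (auto simp: has_fact_def)

lemma has_fact_sum:
  assumes "finite H" "H \<subseteq> N"
  shows "has_fact N (\<Sum>h\<in>H. a h * h) (\<Sum>h\<in>H. a h)"
  using assms
proof induction
  case (insert h H)
  have "has_fact N (k * h) k" for k
  proof (induction k)
    case (Suc k)
    then show ?case using has_fact_add[OF has_fact_single[of h N] Suc] insert.prems by simp
  qed (simp add: has_fact_zero)
  then show ?case using insert has_fact_add[of N "a h * h" "a h"] by simp
qed (simp add: has_fact_zero)

lemma has_fact_in_gen: "has_fact N x l \<Longrightarrow> x \<in> submonoid_gen N"
proof -
  have "set_mset A \<subseteq> N \<Longrightarrow> sum_mset A \<in> submonoid_gen N" for A
    by (induction A) (auto intro: submonoid_gen.intros)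
  then show "has_fact N x l \<Longrightarrow> x \<in> submonoid_gen N" by (auto simp: has_fact_def)
qed

lemma gen_has_fact: "x \<in> submonoid_gen N \<Longrightarrow> \<exists>l. has_fact N x l"
  by (induction rule: submonoid_gen.induct) (blast intro: has_fact_zero has_fact_single has_fact_add)+

lemma submonoid_gen_submonoid: "submonoid_nat (submonoid_gen N)"
  by unfold_locales (auto intro: submonoid_gen.intros)

text \<open>Together with \<open>lev_has_fact\<close> this identifies \<open>ord\<close> with the
  maximal length of a factorization over \<open>N\<close>. Members equal to 0 would allow arbitrary
  lengths.\<close>

lemma has_fact_lev:
  assumes "0 \<notin> N" "has_fact N x l" "k \<le> l"
  shows "x \<in> lev (submonoid_gen N) k"
proof -
  interpret submonoid_nat "submonoid_gen N" by (rule submonoid_gen_submonoid)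
  have "set_mset A \<subseteq> N \<Longrightarrow> sum_mset A \<in> lev (submonoid_gen N) (size A)" for A
  proof (induction A)
    case (add a A)
    then have "sum_mset A \<in> lev (submonoid_gen N) (size A)" "a \<in> submonoid_gen N" "a \<noteq> 0"
      using assms(1) by (auto intro: submonoid_gen.incl intro!: gr0I)
    then have "sum_mset A + a \<in> lev (submonoid_gen N) (Suc (size A))"
      unfolding lev.simps(2) by blast
    then show ?case by (simp add: add.commute)
  qed (simp add: submonoid_gen.zero)
  then have "x \<in> lev (submonoid_gen N) l" using assms(2) by (auto simp: has_fact_def)
  then show ?thesis using lev_antimono assms(3) by blast
qed

lemma lev_has_fact:
  assumes "x \<in> lev (submonoid_gen N) k"
  shows "\<exists>l\<ge>k. has_fact N x l"
  using assms
proof (induction k arbitrary: x)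
  case 0
  then show ?case using gen_has_fact by auto
next
  case (Suc k)
  then obtain a b where ab: "x = a + b" "a \<in> lev (submonoid_gen N) k" "b \<in> submonoid_gen N" "b \<noteq> 0"
    unfolding lev.simps(2) by blast
  obtain l where l: "l \<ge> k" "has_fact N a l" using Suc.IH ab by blast
  obtain l' where l': "has_fact N b l'" using gen_has_fact ab by blast
  have "l' \<noteq> 0"
  proof
    assume "l' = 0"
    then show False using l' ab(4) by (simp add: has_fact_0_iff)
  qed
  then show ?case using has_fact_add[OF l(2) l'] l(1) ab(1) by (intro exI[of _ "l + l'"]) auto
qed



text \<open>The sums of the first 0, ..., m entries are m + 1 numbers, so two of them agree modulo
  m; the block between them is the one sought.\<close>

lemma exists_block_sum_dvd:
  fixes ys :: "nat list"
  assumes "m \<le> length ys" "0 < m"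
  shows "\<exists>us vs ws. ys = us @ vs @ ws \<and> vs \<noteq> [] \<and> m dvd sum_list vs"
proof -
  define P where "P i = sum_list (take i ys) mod m" for i
  have "P ` {..m} \<subseteq> {..<m}" using assms(2) by (auto simp: P_def)
  then have "card (P ` {..m}) \<le> card {..<m}" by (rule card_mono[rotated]) simp
  then have "card (P ` {..m}) < card {..m}" by simp
  then have "\<not> inj_on P {..m}" by (rule pigeonhole)
  then obtain i j where "i \<le> m" "j \<le> m" "i \<noteq> j" "P i = P j" by (auto simp: inj_on_def)
  then obtain i j where ij: "i < j" "j \<le> m" "P i = P j" by (metis linorder_neqE_nat)
  have split: "take j ys = take i ys @ drop i (take j ys)"
    using ij by (metis append_take_drop_id min.strict_order_iff min.commute take_take)
  then have "sum_list (take j ys) = sum_list (take i ys) + sum_list (drop i (take j ys))"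
    by (metis sum_list_append)
  then have "m dvd sum_list (drop i (take j ys))"
    using ij(3) unfolding P_def by (metis add_diff_cancel_left' le_add1 mod_eq_dvd_iff_nat)
  moreover have "drop i (take j ys) \<noteq> []" using ij assms by simp
  moreover have "ys = take i ys @ drop i (take j ys) @ drop j ys"
    using split by (metis append.assoc append_take_drop_id)
  ultimately show ?thesis by blast
qed

text \<open>The number \<open>t\<close> bounds the deficits of all generators but \<open>e\<close>,
  whose own deficit is \<open>D - e\<close>. By \<open>large\<close>, deficits of at most
  \<open>t\<close> can add up to \<open>D\<close> only if at least \<open>D - e\<close> of them are
  nonzero.\<close>

locale shifted_gens =
  fixes N :: "nat set" and D e t :: nat
  assumes D_in: "D \<in> N" and e_in: "e \<in> N" and e_pos: "0 < e" and e_less: "e < D"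
    and between: "x \<in> N \<Longrightarrow> x \<noteq> e \<Longrightarrow> e < x \<and> x \<le> D \<and> D - x \<le> t"
    and large: "(D - e) * t \<le> D"
begin

lemma le_D: "x \<in> N \<Longrightarrow> x \<le> D"
  using between[of x] e_less by (cases "x = e") auto

lemma sum_deficit:
  "set_mset A \<subseteq> N \<Longrightarrow> (\<Sum>x\<in>#A. D - x) + sum_mset A = D * size A"
proof (induction A)
  case (add a A)
  then have "a \<le> D" using le_D by auto
  then show ?case using add by auto
qed simp

text \<open>The deficits \<open>D - x\<close> of the longer factorization add up to at least \<open>D\<close>, so that at least
  \<open>D - e\<close> of its members differ from \<open>D\<close>. Some of these have deficits adding up to a multiple
  \<open>q (D - e)\<close>, and may be replaced by \<open>q\<close> copies of \<open>e\<close> and copies of \<open>D\<close>.\<close>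

lemma exchange:
  assumes A: "set_mset A \<subseteq> N" "e \<notin># A" and B: "set_mset B \<subseteq> N"
    and eq: "sum_mset A = sum_mset B" and less: "size B < size A"
  shows "\<exists>A'. set_mset A' \<subseteq> N \<and> sum_mset A' = sum_mset A \<and> size A' = size A \<and> e \<in># A'"
proof -
  define m where "m = D - e"
  have m: "0 < m" "D = e + m" using e_less by (auto simp: m_def)
  have bt: "e < x \<and> x \<le> D \<and> D - x \<le> t" if "x \<in># A" for x
    using between[of x] that A by blast
  have "(\<Sum>x\<in>#A. D - x) + sum_mset A = D * size A" by (rule sum_deficit[OF A(1)])
  moreover have "sum_mset A \<le> D * size B" using sum_deficit[OF B] eq by linarith
  moreover have "D * Suc (size B) \<le> D * size A" using less by (intro mult_le_mono2) simp
  \<comment> \<open>The deficits of \<open>A\<close> add up to \<open>D * size A\<close> minus the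
    common sum, and the common sum is at most \<open>D * size B\<close>.\<close>
  ultimately have D_le: "D \<le> (\<Sum>x\<in>#A. D - x)" by simp
  define C where "C = filter_mset (\<lambda>x. x \<noteq> D) A"
  have "(\<Sum>x\<in>#A. D - x) \<le> t * size C"
  proof -
    have "\<forall>x\<in>#A. D - x \<le> t \<Longrightarrow> (\<Sum>x\<in>#A. D - x) \<le> t * size (filter_mset (\<lambda>x. x \<noteq> D) A)"
      by (induction A) auto
    then show ?thesis using bt by (auto simp: C_def)
  qed
  then have D_t: "D \<le> size C * t" using D_le by (simp add: mult.commute)
  then have "0 < t" using e_less by (auto intro: gr0I)
  moreover have "m * t \<le> size C * t" using D_t large unfolding m_def by (rule order_trans[rotated])
  ultimately have m_le: "m \<le> size C" by simp
  obtain ys where ys: "mset ys = C" using ex_mset by blast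
  have "m \<le> length (map (\<lambda>x. D - x) ys)" using m_le by (simp flip: ys)
  then obtain us vs ws where split: "map (\<lambda>x. D - x) ys = us @ vs @ ws" "vs \<noteq> []" "m dvd sum_list vs"
    using exists_block_sum_dvd m(1) by blast
  then obtain us' vs' ws' where ys_split: "ys = us' @ vs' @ ws'" "vs = map (\<lambda>x. D - x) vs'"
    unfolding map_eq_append_conv append_eq_map_conv by blast
  define V where "V = mset vs'"
  have "V \<subseteq># C" unfolding V_def ys[symmetric] ys_split(1) by simp
  then have VA: "V \<subseteq># A" unfolding C_def using multiset_filter_subset subset_mset.order_trans by blast
  have V: "0 < D - x \<and> Suc (D - x) \<le> m" if "x \<in># V" for x
  proof -
    have "x \<in># C" using that \<open>V \<subseteq># C\<close> by (rule mset_subset_eqD[rotated])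
    then show ?thesis using bt[of x] m by (auto simp: C_def)
  qed
  have V_ne: "V \<noteq> {#}" using split(2) ys_split(2) by (auto simp: V_def)
  obtain q where q: "(\<Sum>x\<in>#V. D - x) = m * q"
    using split(3) unfolding ys_split(2) V_def by (metis dvdE mset_map sum_mset_sum_list)
  have q_pos: "0 < q"
  proof -
    obtain x where x: "x \<in># V" using V_ne by blast
    then have "D - x \<le> (\<Sum>x\<in>#V. D - x)" by (metis image_eqI in_image_mset sum_mset.remove le_add1)
    then show ?thesis using V[OF x] q by (intro gr0I) auto
  qed
  have "(\<forall>x\<in>#V. Suc (D - x) \<le> m) \<Longrightarrow> (\<Sum>x\<in>#V. D - x) + size V \<le> m * size V"
    by (induction V) auto
  then have "m * q + size V \<le> m * size V" using V q by simp
  then have "m * q \<le> m * size V" by linarith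
  \<comment> \<open>Each deficit in \<open>V\<close> is less than \<open>m\<close> because
    \<open>e\<close> is not in \<open>A\<close>. Hence the \<open>q\<close> copies of
    \<open>e\<close> do not outnumber the members they replace, and copies of \<open>D\<close> make
    up for the rest.\<close>
  then have q_le: "q \<le> size V" using m(1) by simp
  define A' where "A' = (A - V) + replicate_mset q e + replicate_mset (size V - q) D"
  have size_V: "size (A - V) + size V = size A" using VA by (simp flip: size_union)
  have "sum_mset V = q * e + (size V - q) * D"
  proof -
    have "m * q + sum_mset V = D * size V"
      using sum_deficit[of V] A(1) VA q by (metis mset_subset_eqD subset_iff)
    also have "\<dots> = m * q + (q * e + (size V - q) * D)"
    proof -
      have "D * size V = D * q + D * (size V - q)" using q_le by (metis add_mult_distrib2 le_add_diff_inverse)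
      then show ?thesis unfolding m(2) by (simp add: algebra_simps)
    qed
    finally show ?thesis by simp
  qed
  moreover have "sum_mset (A - V) + sum_mset V = sum_mset A" using VA by (simp flip: sum_mset.union)
  ultimately have "sum_mset A' = sum_mset A" by (simp add: A'_def)
  moreover have "size A' = size A" using size_V q_le by (simp add: A'_def)
  moreover have "set_mset A' \<subseteq> N"
    using A(1) D_in e_in by (auto simp: A'_def dest: in_diffD split: if_splits)
  moreover have "e \<in># A'" using q_pos by (simp add: A'_def)
  ultimately show ?thesis by blast
qed

text \<open>If the longer factorization contains \<open>e\<close>, it can be used as it is;
  otherwise \<open>exchange\<close> provides one of the same length that does. Removing
  \<open>e\<close> from it gives \<open>y\<close>.\<close>

lemma has_fact_longer:
  assumes "has_fact N x l" "has_fact N x l'" "l' < l"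
  obtains y where "x = y + e" "has_fact N y (l - 1)"
proof -
  obtain A where A: "set_mset A \<subseteq> N" "sum_mset A = x" "size A = l" using assms(1) by (auto simp: has_fact_def)
  obtain B where B: "set_mset B \<subseteq> N" "sum_mset B = x" "size B = l'" using assms(2) by (auto simp: has_fact_def)
  obtain A' where A': "set_mset A' \<subseteq> N" "sum_mset A' = x" "size A' = l" "e \<in># A'"
    using exchange[OF A(1) _ B(1)] A B assms(3) by metis
  obtain A'' where "A' = add_mset e A''" using A'(4) by (metis insert_DiffM)
  then show ?thesis using A' by (intro that[of "sum_mset A''"]) (auto simp: has_fact_def)
qed

lemma e_le: "x \<in> N \<Longrightarrow> e \<le> x"
  using between[of x] by (cases "x = e") auto

lemma zero_notin: "0 \<notin> N"
  using e_le[of 0] e_pos by auto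

lemma e_le_gen: "x \<in> submonoid_gen N \<Longrightarrow> x \<noteq> 0 \<Longrightarrow> e \<le> x"
  by (induction rule: submonoid_gen.induct) (auto dest: e_le)

text \<open>For \<open>lev_cancel_e\<close>, compare a factorization of x + e of length at least k +
  1 with one obtained by adding \<open>e\<close> to a factorization of x. Either the latter is long
  enough, or the former is longer and can be made to contain \<open>e\<close>, which is then
  removed.\<close>

lemma cm_semigroup:
  assumes "finite (UNIV - submonoid_gen N)"
  shows "cm_semigroup (submonoid_gen N) e"
proof (intro cm_semigroup.intro cm_semigroup_axioms.intro submonoid_gen_submonoid)
  fix x k assume x: "x \<in> submonoid_gen N" and lev: "x + e \<in> lev (submonoid_gen N) (Suc k)"
  obtain l where l: "has_fact N (x + e) l" "Suc k \<le> l" using lev_has_fact[OF lev] by blast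
  obtain l' where l': "has_fact N x l'" using gen_has_fact x by blast
  then have l'': "has_fact N (x + e) (l' + 1)" using has_fact_add has_fact_single e_in by blast
  show "x \<in> lev (submonoid_gen N) k"
  proof (cases "k \<le> l'")
    case True
    then show ?thesis using has_fact_lev[OF zero_notin l'] by blast
  next
    case False
    then obtain y where "x + e = y + e" "has_fact N y (l - 1)"
      using has_fact_longer[OF l(1) l''] l(2) by auto
    then show ?thesis using has_fact_lev[OF zero_notin] l(2) by (metis add_right_cancel diff_Suc_1 diff_le_mono)
  qed
qed (use assms e_in e_pos e_le_gen in \<open>auto intro: submonoid_gen.incl\<close>)

text \<open>The minimal generators lie in \<open>N\<close> and \<open>e\<close> is the least of
  them. Of two factorizations of different lengths, the longer one shows that x - e is in the
  semigroup, so that x is not in the Apery set.\<close>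

lemma homogeneous:
  assumes "finite N"
  shows "homogeneous (submonoid_gen N)"
proof -
  let ?S = "submonoid_gen N"
  interpret submonoid_nat ?S by (rule submonoid_gen_submonoid)
  have sub: "min_gens ?S \<subseteq> N"
    using irreducible_in_generators[of _ N] by (auto simp: min_gens_iff)
  then have fin: "finite (min_gens ?S)" using assms finite_subset by blast
  have "e \<in> min_gens ?S"
  proof -
    have "e \<noteq> y + z" if "y \<in> ?S" "z \<in> ?S" "y \<noteq> 0" "z \<noteq> 0" for y z
      using e_le_gen[OF that(1,3)] that(4) by simp
    then show ?thesis using e_in e_pos by (auto simp: min_gens_iff intro: submonoid_gen.incl)
  qed
  then have Min: "Min (min_gens ?S) = e" using sub e_le fin by (intro Min_eqI) auto
  have le: "sum a (min_gens ?S) \<le> sum b (min_gens ?S)"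
    if x: "x \<in> apery ?S e" and ab: "(\<Sum>h\<in>min_gens ?S. a h * h) = x" "(\<Sum>h\<in>min_gens ?S. b h * h) = x" for x a b
  proof (rule ccontr)
    assume "\<not> ?thesis"
    then obtain y where "x = y + e" "has_fact N y (sum a (min_gens ?S) - 1)"
      using has_fact_longer has_fact_sum[OF fin sub] ab by (metis not_le)
    then have "y \<in> ?S" "int x - int e = int y" using has_fact_in_gen by auto
    then show False using x by (auto simp: apery_def)
  qed
  show ?thesis
    unfolding homogeneous_def Min by (intro ballI impI allI order_antisym; rule le; assumption)
qed

end

section \<open>The shifting type and the bound on the smallest generator\<close>

theorem proposition6p9:
  fixes d e g c :: nat and s n :: "nat \<Rightarrow> nat" and T S :: "nat set" and L :: real
  assumes "2 \<le> d"
    and "s 0 = 0" and "strict_mono_on {0..d - 1} s"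
    and "g = Gcd (s ` {1..d - 1})"
    and "T = submonoid_gen ((\<lambda>i. s i div g) ` {1..d - 1})"
    and "c = conductor T"
    and "L = real (s (d - 1)) * real (s (d - 2)) *
               ((real g * real c + real d * real (s (d - 1))) / real (s 1) + real d)
             - real (s (d - 1)) - 1"
    and "real e > L"
    and "shifting_type d n s" and "n 1 = e"
    and "S = submonoid_gen (n ` {1..d})" and "numerical_semigroup S"
  shows "homogeneous S \<and>
         cohen_macaulay (graded_semigroup_ring S :: (nat \<Rightarrow> 'k::field poly set) ring)"
proof -
  have pos: "\<And>i. i \<in> {1..d} \<Longrightarrow> 0 < n i" and mono: "strict_mono_on {1..d} n"
    and shift: "\<And>i. i \<in> {1..d - 1} \<Longrightarrow> int (s i) = int (n d) - int (n (d - i))"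
    using assms(9) by (auto simp: shifting_type_def)
  have "d - 1 \<in> {1..d - 1}" "d - (d - 1) = 1" using assms(1) by auto
  then have "int (s (d - 1)) = int (n d) - int e" using shift[of "d - 1"] assms(10) by metis
  then have sd: "s (d - 1) = n d - e" and "e \<le> n d" by linarith+
  have large: "s (d - 1) * s (d - 2) \<le> n d"
  proof -
    define P F where "P = real (s (d - 1)) * real (s (d - 2))"
      and "F = (real g * real c + real d * real (s (d - 1))) / real (s 1) + real d"
    \<comment> \<open>\<open>F\<close> is a nonnegative fraction plus \<open>d\<close>.\<close>
    have "1 \<le> F" using assms(1) unfolding F_def by (intro order_trans[OF _ le_add_same_cancel2[THEN iffD2]]) auto
    then have "P * 1 \<le> P * F" by (intro mult_left_mono) (auto simp: P_def)
    \<comment> \<open>The summand - s_{d-1} - 1 of \<open>L\<close> fits here: e + s_{d-1} is n_d,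
      so the integer \<open>P\<close> is less than n_d + 1.\<close>
    then have "P < real e + real (s (d - 1)) + 1" using assms(7,8) unfolding P_def F_def by linarith
    then have "real (s (d - 1) * s (d - 2)) < real (e + s (d - 1) + 1)" unfolding P_def by simp
    then have "s (d - 1) * s (d - 2) < e + s (d - 1) + 1" by (simp only: of_nat_less_iff)
    then show ?thesis using sd \<open>e \<le> n d\<close> by linarith
  qed
  \<comment> \<open>The second smallest generator n_2 has deficit s_{d-2}, which bounds the deficits
    of all generators other than \<open>e\<close>. For d = 2 it is s_0 = 0.\<close>
  interpret shifted_gens "n ` {1..d}" "n d" e "s (d - 2)"
  proof
    show "n d \<in> n ` {1..d}" "e \<in> n ` {1..d}" using assms(1,10) by auto
    show "0 < e" using pos[of 1] assms(1,10) by simp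
    show "e < n d" using strict_mono_onD[OF mono, of 1 d] assms(1,10) by simp
    show "(n d - e) * s (d - 2) \<le> n d" using large sd by simp
    fix x assume "x \<in> n ` {1..d}" "x \<noteq> e"
    then obtain j where "x = n j" "1 \<le> j" "j \<le> d" by auto
    moreover from this have "j \<noteq> 1" using \<open>x \<noteq> e\<close> assms(10) by blast
    ultimately have j: "x = n j" "2 \<le> j" "j \<le> d" by auto
    have "e < x" using strict_mono_onD[OF mono, of 1 j] j assms(10) by simp
    moreover have "x \<le> n d" using strict_mono_onD[OF mono, of j d] j by (cases "j = d") auto
    moreover have "n d - x \<le> s (d - 2)"
    proof (cases "j = d")
      case False
      then have "d - j \<in> {1..d - 1}" "d - (d - j) = j" using j by auto
      then have "int (s (d - j)) = int (n d) - int x" using shift[of "d - j"] j(1) by metis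
      moreover have "s (d - j) \<le> s (d - 2)"
        using strict_mono_on_leD[OF assms(3), of "d - j" "d - 2"] j by simp
      ultimately show ?thesis by linarith
    qed (simp add: j)
    ultimately show "e < x \<and> x \<le> n d \<and> n d - x \<le> s (d - 2)" by blast
  qed
  have "finite (UNIV - S)" using assms(12) by (simp add: numerical_semigroup_def)
  then show ?thesis
    using homogeneous cm_semigroup.cohen_macaulay_graded_semigroup_ring[OF cm_semigroup]
    unfolding assms(11) by simp
qed

end
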